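(* Fix an integer $k\ge2$, $m\ge1$ and $\varepsilon\in(0,1/k]$. Let $\theta_0=(\pi_0,\mu_0,t_0)\in\mathcal S_{m,\varepsilon}$ satisfy (i) $\min_j(\pi_0)_j>0$ and (ii) $(\mu_{0j},t_{0j})\ne(\mu_{0\ell},t_{0\ell})$ for all $j\neq\ell$. Let $X_1,X_2,\dots$ be i.i.d. from the Gaussian mixture density $f_{\theta_0}$, let $\ell_n(\theta)=\sum_{i=1}^n\log f_\theta(X_i)$, and let $$\widehat\Theta_{n,m,\varepsilon}:=\arg\max_{\theta\in\mathcal S_{m,\varepsilon}}\ell_n(\theta).$$ Then, almost surely, $$d_H^{d_{\mathfrak S_k}}\big(\widehat\Theta_{n,m,\varepsilon},[\theta_0]\big)\to0\quad(n\to\infty).$$ Equivalently, in the Hausdorff distance $d_H$ for the quotient metric on $\mathcal S_{m,\varepsilon}/\mathfrak S_k$, $d_H\big(\mathrm{pr}(\widehat\Theta_{n,m,\varepsilon}),\{[\theta_0]\}\big)\to0$ almost surely, where $\mathrm{pr}:\mathcal S_{m,\varepsilon}\to\mathcal S_{m,\varepsilon}/\mathfrak S_k$ is the quotient map.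
   Context: For $\theta=(\pi,\mu,t)$ in $\Theta_k=\Delta_{k-1}\times\mathbb{R}^k\times\mathbb{R}^k$, with $\Delta_{k-1}=\{\pi\in[0,1]^k:\sum_j\pi_j=1\}$ and $\sigma_j=e^{t_j}$, the $k$-component Gaussian mixture density is $f_\theta(x)=\sum_{j=1}^k\pi_j\varphi(x;\mu_j,\sigma_j)$, where $\varphi(x;\mu,\sigma)=\frac{1}{\sqrt{2\pi}\,\sigma}\exp(-\frac{(x-\mu)^2}{2\sigma^2})$. The sieve is $\mathcal S_{m,\varepsilon}=\{\pi\in\Delta_{k-1}:\min_j\pi_j\ge\varepsilon\}\times[-m,m]^k\times[-m,m]^k$, in coordinates $(\pi,\mu,t)$. The symmetric group $\mathfrak S_k$ acts by simultaneously permuting the coordinates of $\pi,\mu,t$; $[\theta]=\{\tau\cdot\theta:\tau\in\mathfrak S_k\}$; $d_{\mathfrak S_k}(\theta,\theta')=\min_{\tau\in\mathfrak S_k}\|\theta-\tau\cdot\theta'\|_2$, which induces a metric on the quotient. $d_H^{d_{\mathfrak S_k}}(A,B)=\max\{\sup_{a\in A}\inf_{b\in B}d_{\mathfrak S_k}(a,b),\ \sup_{b\in B}\inf_{a\in A}d_{\mathfrak S_k}(a,b)\}$ for nonempty $A,B$. *)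

theory Defs
  imports "HOL-Probability.Probability"
begin

text \<open>
  A parameter is a triple \<open>(\<pi>, \<mu>, t)\<close> of weights, means and log standard deviations, the
  number of components being \<open>CARD('k)\<close>. The norm of the product type is
  the Euclidean norm of the concatenated vector.
\<close>

type_synonym 'k param = "(real ^ 'k) \<times> (real ^ 'k) \<times> (real ^ 'k)"

definition prob_simplex :: "(real ^ 'k) set"
  where "prob_simplex = {p. (\<forall>j. p $ j \<in> {0..1}) \<and> (\<Sum>j\<in>UNIV. p $ j) = 1}"

definition mixture_density :: "'k::finite param \<Rightarrow> real \<Rightarrow> real"
  where "mixture_density = (\<lambda>(p, \<mu>, t) x. \<Sum>j\<in>UNIV. p $ j * normal_density (\<mu> $ j) (exp (t $ j)) x)"

definition sieve :: "real \<Rightarrow> real \<Rightarrow> ('k::finite param) set"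
  where "sieve m \<epsilon> =
    {p \<in> prob_simplex. (MIN j. p $ j) \<ge> \<epsilon>}
      \<times> {\<mu>. \<forall>j. \<mu> $ j \<in> {-m..m}} \<times> {t. \<forall>j. t $ j \<in> {-m..m}}"

text \<open>The inverse makes this a left action.\<close>

definition perm_act :: "('k \<Rightarrow> 'k) \<Rightarrow> 'k::finite param \<Rightarrow> 'k param"
  where "perm_act \<tau> = (\<lambda>(p, \<mu>, t).
    (\<chi> j. p $ inv \<tau> j, \<chi> j. \<mu> $ inv \<tau> j, \<chi> j. t $ inv \<tau> j))"

definition perm_orbit :: "'k::finite param \<Rightarrow> ('k param) set"
  where "perm_orbit \<theta> = {perm_act \<tau> \<theta> |\<tau>. \<tau> permutes UNIV}"

definition perm_dist :: "'k::finite param \<Rightarrow> 'k param \<Rightarrow> real"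
  where "perm_dist \<theta> \<theta>' = (MIN \<tau>\<in>{\<tau>. \<tau> permutes UNIV}. norm (\<theta> - perm_act \<tau> \<theta>'))"

text \<open>
  The distance induced on orbits: the common value of \<^const>\<open>perm_dist\<close> on representatives.
  The lemmas \<open>orbit_dist_perm_orbit\<close> and \<open>orbit_dist_metric\<close> below show that it is well
  defined and a metric.
\<close>

definition orbit_dist :: "('k::finite param) set \<Rightarrow> ('k param) set \<Rightarrow> real"
  where "orbit_dist P Q = (THE r. \<forall>\<theta>\<in>P. \<forall>\<theta>'\<in>Q. perm_dist \<theta> \<theta>' = r)"

text \<open>
  The Hausdorff distance takes values in \<^typ>\<open>ereal\<close>, so that suprema and infima always
  exist; in particular, it is infinite if exactly one of the two sets is empty.
\<close>

definition hausdorff_dist :: "('a \<Rightarrow> 'a \<Rightarrow> real) \<Rightarrow> 'a set \<Rightarrow> 'a set \<Rightarrow> ereal"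
  where "hausdorff_dist d A B =
    max (SUP a\<in>A. INF b\<in>B. ereal (d a b)) (SUP b\<in>B. INF a\<in>A. ereal (d a b))"

text \<open>Observations are indexed from \<open>0\<close>: the sample of size \<open>n\<close> is \<open>x 0, \<dots>, x (n - 1)\<close>.\<close>

definition log_likelihood :: "(nat \<Rightarrow> real) \<Rightarrow> nat \<Rightarrow> 'k::finite param \<Rightarrow> real"
  where "log_likelihood x n \<theta> = (\<Sum>i<n. ln (mixture_density \<theta> (x i)))"

definition sieve_mle :: "real \<Rightarrow> real \<Rightarrow> (nat \<Rightarrow> real) \<Rightarrow> nat \<Rightarrow> ('k::finite param) set"
  where "sieve_mle m \<epsilon> x n = {\<theta>. is_arg_max (log_likelihood x n) (\<lambda>\<theta>. \<theta> \<in> sieve m \<epsilon>) \<theta>}"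


lemma perm_act_id: "perm_act id \<theta> = \<theta>"
  by (cases \<theta>) (simp add: perm_act_def vec_eq_iff)

lemma perm_act_comp:
  assumes "\<sigma> permutes UNIV" "\<tau> permutes UNIV"
  shows "perm_act \<sigma> (perm_act \<tau> \<theta>) = perm_act (\<sigma> \<circ> \<tau>) \<theta>"
  using assms by (cases \<theta>) (simp add: perm_act_def vec_eq_iff o_inv_distrib permutes_bij)

lemma norm_vec_permute:
  fixes v :: "real ^ 'k"
  assumes "\<tau> permutes UNIV"
  shows "norm (\<chi> j. v $ inv \<tau> j) = norm v"
proof -
  have "(\<Sum>j\<in>UNIV. (v $ inv \<tau> j)\<^sup>2) = (\<Sum>j\<in>UNIV. (v $ j)\<^sup>2)"
    using sum.permute[OF permutes_inv[OF assms], of "\<lambda>j. (v $ j)\<^sup>2"] by (simp add: o_def)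
  then show ?thesis by (simp add: norm_vec_def L2_set_def)
qed

lemma perm_act_diff: "perm_act \<tau> (\<theta> - \<theta>') = perm_act \<tau> \<theta> - perm_act \<tau> \<theta>'"
  by (cases \<theta>; cases \<theta>') (simp add: perm_act_def vec_eq_iff)

lemma norm_perm_act: "\<tau> permutes UNIV \<Longrightarrow> norm (perm_act \<tau> \<theta>) = norm \<theta>"
  by (cases \<theta>) (simp add: perm_act_def norm_prod_def norm_vec_permute)

lemma perm_dist_le:
  "\<tau> permutes UNIV \<Longrightarrow> perm_dist \<theta> \<theta>' \<le> norm (\<theta> - perm_act \<tau> \<theta>')"
  unfolding perm_dist_def by (rule Min_le) (auto simp: finite_permutations)

lemma perm_dist_attained:
  obtains \<tau> where "\<tau> permutes UNIV" "perm_dist \<theta> \<theta>' = norm (\<theta> - perm_act \<tau> \<theta>')"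
proof -
  have "perm_dist \<theta> \<theta>' \<in> (\<lambda>\<tau>. norm (\<theta> - perm_act \<tau> \<theta>')) ` {\<tau>. \<tau> permutes UNIV}"
    unfolding perm_dist_def
    by (rule Min_in) (use permutes_id in \<open>auto simp: finite_permutations intro!: exI[of _ id]\<close>)
  then show ?thesis using that by auto
qed

lemma perm_dist_act_le:
  assumes s: "\<sigma> permutes UNIV" and r: "\<rho> permutes UNIV"
  shows "perm_dist (perm_act \<sigma> \<theta>) (perm_act \<rho> \<theta>') \<le> perm_dist \<theta> \<theta>'"
proof -
  obtain \<tau> where t: "\<tau> permutes UNIV" "perm_dist \<theta> \<theta>' = norm (\<theta> - perm_act \<tau> \<theta>')"
    by (rule perm_dist_attained)
  let ?k = "\<sigma> \<circ> \<tau> \<circ> inv \<rho>"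
  have k: "?k permutes UNIV" by (intro permutes_compose permutes_inv s r t)
  have st: "(\<sigma> \<circ> \<tau>) permutes UNIV" by (intro permutes_compose s t)
  have "perm_act ?k (perm_act \<rho> \<theta>') = perm_act (\<sigma> \<circ> \<tau> \<circ> (inv \<rho> \<circ> \<rho>)) \<theta>'"
    using perm_act_comp[OF k r] by (simp add: o_assoc)
  also have "\<dots> = perm_act \<sigma> (perm_act \<tau> \<theta>')"
    using permutes_inv_o(2)[OF r] perm_act_comp[OF s t(1)] by simp
  finally have "norm (perm_act \<sigma> \<theta> - perm_act ?k (perm_act \<rho> \<theta>')) = perm_dist \<theta> \<theta>'"
    by (simp add: t(2) perm_act_diff[symmetric] norm_perm_act[OF s])
  then show ?thesis using perm_dist_le[OF k] by metis
qed

lemma perm_dist_act: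
  assumes s: "\<sigma> permutes UNIV" and r: "\<rho> permutes UNIV"
  shows "perm_dist (perm_act \<sigma> \<theta>) (perm_act \<rho> \<theta>') = perm_dist \<theta> \<theta>'"
proof (rule antisym)
  have "perm_dist (perm_act (inv \<sigma>) (perm_act \<sigma> \<theta>)) (perm_act (inv \<rho>) (perm_act \<rho> \<theta>'))
      \<le> perm_dist (perm_act \<sigma> \<theta>) (perm_act \<rho> \<theta>')"
    by (intro perm_dist_act_le permutes_inv s r)
  then show "perm_dist \<theta> \<theta>' \<le> perm_dist (perm_act \<sigma> \<theta>) (perm_act \<rho> \<theta>')"
    using s r by (simp add: perm_act_comp permutes_inv permutes_inv_o perm_act_id)
qed (rule perm_dist_act_le[OF s r])

lemma perm_orbit_refl: "\<theta> \<in> perm_orbit \<theta>"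
  unfolding perm_orbit_def using permutes_id perm_act_id by (metis (mono_tags, lifting) mem_Collect_eq)

lemma orbit_dist_perm_orbit: "orbit_dist (perm_orbit \<theta>) (perm_orbit \<theta>') = perm_dist \<theta> \<theta>'"
  unfolding orbit_dist_def
proof (rule the_equality)
  show "\<forall>a\<in>perm_orbit \<theta>. \<forall>b\<in>perm_orbit \<theta>'. perm_dist a b = perm_dist \<theta> \<theta>'"
    by (auto simp: perm_orbit_def perm_dist_act)
  show "r = perm_dist \<theta> \<theta>'"
    if "\<forall>a\<in>perm_orbit \<theta>. \<forall>b\<in>perm_orbit \<theta>'. perm_dist a b = r" for r
    using that perm_orbit_refl by metis
qed

lemma perm_dist_nonneg: "0 \<le> perm_dist \<theta> \<theta>'"
  by (rule perm_dist_attained[of \<theta> \<theta>']) simp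

lemma perm_dist_sym_le: "perm_dist \<theta>' \<theta> \<le> perm_dist \<theta> \<theta>'"
proof -
  obtain \<tau> where t: "\<tau> permutes UNIV" "perm_dist \<theta> \<theta>' = norm (\<theta> - perm_act \<tau> \<theta>')"
    by (rule perm_dist_attained)
  have "perm_dist \<theta>' \<theta> = perm_dist (perm_act \<tau> \<theta>') (perm_act id \<theta>)"
    by (rule perm_dist_act[symmetric]) (use t permutes_id in auto)
  also have "\<dots> \<le> norm (perm_act \<tau> \<theta>' - perm_act id (perm_act id \<theta>))"
    by (rule perm_dist_le) (rule permutes_id)
  also have "\<dots> = perm_dist \<theta> \<theta>'"
    by (simp add: perm_act_id t(2) norm_minus_commute)
  finally show ?thesis .
qed

lemma perm_dist_sym: "perm_dist \<theta> \<theta>' = perm_dist \<theta>' \<theta>"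
  by (intro antisym perm_dist_sym_le)

lemma perm_dist_triangle: "perm_dist a c \<le> perm_dist a b + perm_dist b c"
proof -
  obtain \<sigma> where s: "\<sigma> permutes UNIV" "perm_dist a b = norm (a - perm_act \<sigma> b)"
    by (rule perm_dist_attained)
  obtain \<tau> where t: "\<tau> permutes UNIV" "perm_dist b c = norm (b - perm_act \<tau> c)"
    by (rule perm_dist_attained)
  have "perm_dist a c \<le> norm (a - perm_act (\<sigma> \<circ> \<tau>) c)"
    by (intro perm_dist_le permutes_compose s t)
  also have "a - perm_act (\<sigma> \<circ> \<tau>) c = (a - perm_act \<sigma> b) + perm_act \<sigma> (b - perm_act \<tau> c)"
    by (simp add: perm_act_diff perm_act_comp s t)
  also have "norm \<dots> \<le> perm_dist a b + perm_dist b c"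
    by (rule order_trans[OF norm_triangle_ineq]) (simp add: norm_perm_act s t)
  finally show ?thesis .
qed

lemma perm_orbit_act:
  assumes "\<tau> permutes UNIV"
  shows "perm_orbit (perm_act \<tau> \<theta>) = perm_orbit \<theta>"
proof -
  have *: "perm_orbit (perm_act \<tau> \<theta>) \<subseteq> perm_orbit \<theta>" if "\<tau> permutes UNIV" for \<tau> and \<theta> :: "'k::finite param"
    unfolding perm_orbit_def using that perm_act_comp permutes_compose by blast
  have "perm_act (inv \<tau>) (perm_act \<tau> \<theta>) = \<theta>"
    using assms by (simp add: perm_act_comp permutes_inv permutes_inv_o perm_act_id)
  then show ?thesis
    using *[OF assms, of \<theta>] *[OF permutes_inv[OF assms], of "perm_act \<tau> \<theta>"] by auto
qed

lemma perm_dist_eq_0_iff: "perm_dist \<theta> \<theta>' = 0 \<longleftrightarrow> perm_orbit \<theta> = perm_orbit \<theta>'"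
proof
  assume "perm_dist \<theta> \<theta>' = 0"
  then obtain \<tau> where "\<tau> permutes UNIV" "\<theta> = perm_act \<tau> \<theta>'"
    using perm_dist_attained[of \<theta> \<theta>'] by (metis norm_eq_zero right_minus_eq)
  then show "perm_orbit \<theta> = perm_orbit \<theta>'" by (simp add: perm_orbit_act)
next
  assume "perm_orbit \<theta> = perm_orbit \<theta>'"
  then obtain \<tau> where t: "\<tau> permutes UNIV" "\<theta> = perm_act \<tau> \<theta>'"
    using perm_orbit_refl[of \<theta>] by (auto simp: perm_orbit_def)
  then show "perm_dist \<theta> \<theta>' = 0"
    using perm_dist_le[OF t(1), of \<theta> \<theta>'] perm_dist_nonneg[of \<theta> \<theta>'] by simp
qed

lemma orbit_dist_metric:
  assumes "P \<in> range perm_orbit" "Q \<in> range perm_orbit" "R \<in> range perm_orbit"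
  shows "0 \<le> orbit_dist P Q"
    and "orbit_dist P Q = 0 \<longleftrightarrow> P = Q"
    and "orbit_dist P Q = orbit_dist Q P"
    and "orbit_dist P R \<le> orbit_dist P Q + orbit_dist Q R"
  using assms
  by (auto simp only: orbit_dist_perm_orbit perm_dist_nonneg perm_dist_eq_0_iff
      perm_dist_triangle intro: perm_dist_sym)

end

theory Submission
  imports Defs "HOL-Real_Asymp.Real_Asymp"
begin

text \<open>
  This is Wald's argument on a compact set. Both Hausdorff distances tend to 0 as soon as the
  maximizers eventually lie within every \<open>\<delta>\<close> of the orbit of \<open>\<theta>\<^sub>0\<close>. Finite Gaussian mixtures are
  identifiable, because distinct normal densities are linearly independent; hence by Gibbs'
  inequality \<open>ln f\<^sub>\<theta> - ln f\<^sub>\<theta>\<^sub>0\<close> has negative mean for every \<open>\<theta>\<close> off the orbit. On the sieve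
  \<open>ln f\<^sub>\<theta> x\<close> is Lipschitz in \<open>\<theta>\<close> with a constant \<open>C * (1 + x\<^sup>2)\<close> that has moments of all orders, so
  the strong law of large numbers, applied to finitely many centres \<open>\<theta>\<close> and to \<open>1 + x\<^sup>2\<close>, makes the
  log-likelihood ratio negative uniformly on the compact set of \<open>\<theta>\<close> at distance at least \<open>\<delta>\<close>.
\<close>

section \<open>A strong law of large numbers under fourth moments\<close>

text \<open>Splitting at \<open>\<bar>y\<bar> = 1\<close>, either 1 or the fourth power dominates.
  Hence a fourth moment controls all lower ones.\<close>

lemma power_le_1_plus_power4:
  fixes y :: real
  assumes "k \<le> 4"
  shows "\<bar>y ^ k\<bar> \<le> 1 + y ^ 4"
proof (cases "\<bar>y\<bar> \<le> 1")
  case True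
  then have "\<bar>y ^ k\<bar> \<le> 1" by (simp add: power_abs power_le_one)
  moreover have "0 \<le> y ^ 4" by simp
  ultimately show ?thesis by linarith
next
  case False
  then have "\<bar>y\<bar> ^ k \<le> \<bar>y\<bar> ^ 4" using assms by (intro power_increasing) auto
  then show ?thesis by (simp add: power_abs)
qed

context prob_space
begin

lemma integrable_power_le4:
  fixes Y :: "'a \<Rightarrow> real"
  assumes [measurable]: "random_variable borel Y" and "integrable M (\<lambda>\<omega>. Y \<omega> ^ 4)" "k \<le> 4"
  shows "integrable M (\<lambda>\<omega>. Y \<omega> ^ k)"
proof (rule Bochner_Integration.integrable_bound)
  show "integrable M (\<lambda>\<omega>. 1 + Y \<omega> ^ 4)" using assms by simp
  show "AE \<omega> in M. norm (Y \<omega> ^ k) \<le> norm (1 + Y \<omega> ^ 4)"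
    using power_le_1_plus_power4[OF assms(3)] by (auto intro: order_trans[OF _ abs_ge_self])
qed simp

text \<open>Powers of independent variables are independent, so mixed moments factorize. This
  evaluates the cross terms when a power of a sum is expanded.\<close>

lemma indep_var_expectation_power:
  fixes S Y :: "'a \<Rightarrow> real"
  assumes "indep_var borel S borel Y"
    and "integrable M (\<lambda>\<omega>. S \<omega> ^ 4)" "integrable M (\<lambda>\<omega>. Y \<omega> ^ 4)" "j \<le> 4" "k \<le> 4"
  shows "integrable M (\<lambda>\<omega>. S \<omega> ^ j * Y \<omega> ^ k)"
    and "expectation (\<lambda>\<omega>. S \<omega> ^ j * Y \<omega> ^ k)
           = expectation (\<lambda>\<omega>. S \<omega> ^ j) * expectation (\<lambda>\<omega>. Y \<omega> ^ k)"
proof -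
  have "indep_var borel ((\<lambda>x. x ^ j) \<circ> S) borel ((\<lambda>x. x ^ k) \<circ> Y)"
    by (rule indep_var_compose[OF assms(1)]) auto
  then have ind: "indep_var borel (\<lambda>\<omega>. S \<omega> ^ j) borel (\<lambda>\<omega>. Y \<omega> ^ k)"
    by (simp add: o_def)
  have "random_variable borel S" "random_variable borel Y"
    using indep_var_rv1[OF assms(1)] indep_var_rv2[OF assms(1)] by auto
  then have int: "integrable M (\<lambda>\<omega>. S \<omega> ^ j)" "integrable M (\<lambda>\<omega>. Y \<omega> ^ k)"
    using integrable_power_le4 assms by auto
  show "integrable M (\<lambda>\<omega>. S \<omega> ^ j * Y \<omega> ^ k)"
    by (rule indep_var_integrable[OF ind int])
  show "expectation (\<lambda>\<omega>. S \<omega> ^ j * Y \<omega> ^ k)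
           = expectation (\<lambda>\<omega>. S \<omega> ^ j) * expectation (\<lambda>\<omega>. Y \<omega> ^ k)"
    by (rule indep_var_lebesgue_integral[OF ind int])
qed

text \<open>The odd cross terms vanish since the new summand is centred and independent of the partial sum.\<close>

lemma fourth_moment_sum_bound:
  fixes Y :: "nat \<Rightarrow> 'a \<Rightarrow> real"
  assumes indep: "indep_vars (\<lambda>_. borel) Y UNIV"
    and int: "\<And>i. integrable M (\<lambda>\<omega>. Y i \<omega> ^ 4)"
    and mean: "\<And>i. expectation (Y i) = 0"
    and var: "\<And>i. expectation (\<lambda>\<omega>. Y i \<omega> ^ 2) \<le> v"
    and kurt: "\<And>i. expectation (\<lambda>\<omega>. Y i \<omega> ^ 4) \<le> \<kappa>"
  shows "integrable M (\<lambda>\<omega>. (\<Sum>i<n. Y i \<omega>) ^ 4)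
    \<and> expectation (\<lambda>\<omega>. \<Sum>i<n. Y i \<omega>) = 0
    \<and> expectation (\<lambda>\<omega>. (\<Sum>i<n. Y i \<omega>) ^ 2) \<le> n * v
    \<and> expectation (\<lambda>\<omega>. (\<Sum>i<n. Y i \<omega>) ^ 4) \<le> n * \<kappa> + 3 * (real n)\<^sup>2 * v\<^sup>2"
proof (induction n)
  case 0
  then show ?case by simp
next
  case (Suc n)
  let ?S = "\<lambda>\<omega>. \<Sum>i<n. Y i \<omega>"
  have Y[measurable]: "random_variable borel (Y i)" for i
    using indep by (auto simp: indep_vars_def)
  have "indep_var borel (Y n) borel ?S"
    by (rule indep_vars_sum) (auto intro: indep_vars_subset[OF indep])
  note E = indep_var_expectation_power[OF this int conjunct1[OF Suc.IH]]
  have v0: "0 \<le> v" by (rule order_trans[OF _ var[of 0]]) simp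
  have int': "integrable M (\<lambda>\<omega>. Y n \<omega> ^ k)" "integrable M (\<lambda>\<omega>. ?S \<omega> ^ k)" if "k \<le> 4" for k
    using that integrable_power_le4[OF Y int] integrable_power_le4[OF _ conjunct1[OF Suc.IH]] by auto
  have int1: "integrable M (Y n)" "integrable M ?S" using int'[of 1] by auto
  have sq: "(\<Sum>i<Suc n. Y i \<omega>) ^ 2 = ?S \<omega> ^ 2 + 2 * (Y n \<omega> ^ 1 * ?S \<omega> ^ 1) + Y n \<omega> ^ 2" for \<omega>
    by (simp add: power2_eq_square algebra_simps)
  have q: "(\<Sum>i<Suc n. Y i \<omega>) ^ 4 = ?S \<omega> ^ 4 + 4 * (Y n \<omega> ^ 1 * ?S \<omega> ^ 3)
      + 6 * (Y n \<omega> ^ 2 * ?S \<omega> ^ 2) + 4 * (Y n \<omega> ^ 3 * ?S \<omega> ^ 1) + Y n \<omega> ^ 4" for \<omega>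
    by (simp add: power2_eq_square power3_eq_cube power4_eq_xxxx algebra_simps)
  have "integrable M (\<lambda>\<omega>. (\<Sum>i<Suc n. Y i \<omega>) ^ 4)"
    unfolding q by (intro Bochner_Integration.integrable_add integrable_mult_right E int') auto
  moreover have "expectation (\<lambda>\<omega>. \<Sum>i<Suc n. Y i \<omega>) = 0"
    using Suc.IH mean int1 by simp
  moreover have "expectation (\<lambda>\<omega>. (\<Sum>i<Suc n. Y i \<omega>) ^ 2)
      = expectation (\<lambda>\<omega>. ?S \<omega> ^ 2) + expectation (\<lambda>\<omega>. Y n \<omega> ^ 2)"
    unfolding sq using E[of 1 1] int' mean Suc.IH by simp
  then have "expectation (\<lambda>\<omega>. (\<Sum>i<Suc n. Y i \<omega>) ^ 2) \<le> Suc n * v"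
    using Suc.IH var[of n] by (simp add: algebra_simps)
  moreover have "expectation (\<lambda>\<omega>. (\<Sum>i<Suc n. Y i \<omega>) ^ 4)
      = expectation (\<lambda>\<omega>. ?S \<omega> ^ 4)
        + 6 * (expectation (\<lambda>\<omega>. Y n \<omega> ^ 2) * expectation (\<lambda>\<omega>. ?S \<omega> ^ 2))
        + expectation (\<lambda>\<omega>. Y n \<omega> ^ 4)"
    unfolding q using E[of 1 3] E[of 2 2] E[of 3 1] int' mean Suc.IH by simp
  \<comment> \<open>The only surviving cross term has even powers; this is why the variance bound is
    carried along in the induction.\<close>
  moreover have "expectation (\<lambda>\<omega>. Y n \<omega> ^ 2) * expectation (\<lambda>\<omega>. ?S \<omega> ^ 2) \<le> v * (n * v)"
    using var[of n] Suc.IH v0 by (intro mult_mono) auto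
  then have "expectation (\<lambda>\<omega>. ?S \<omega> ^ 4)
        + 6 * (expectation (\<lambda>\<omega>. Y n \<omega> ^ 2) * expectation (\<lambda>\<omega>. ?S \<omega> ^ 2))
        + expectation (\<lambda>\<omega>. Y n \<omega> ^ 4) \<le> (n * \<kappa> + 3 * (real n)\<^sup>2 * v\<^sup>2) + 6 * (v * (n * v)) + \<kappa>"
    using Suc.IH kurt[of n] by linarith
  \<comment> \<open>Since 3n^2 + 6n = 3(n+1)^2 - 3, the induction closes with
    \<open>3 * v\<^sup>2\<close> to spare.\<close>
  moreover have "(n * \<kappa> + 3 * (real n)\<^sup>2 * v\<^sup>2) + 6 * (v * (n * v)) + \<kappa>
      = Suc n * \<kappa> + 3 * (real (Suc n))\<^sup>2 * v\<^sup>2 - 3 * v\<^sup>2"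
    by (simp add: power2_eq_square algebra_simps)
  ultimately show ?case by (smt (verit) zero_le_power2)
qed

text \<open>The fourth moment of the n-th average is of order 1/n^2, hence summable. So the sum of
  the fourth powers of the averages has finite expectation, is almost surely finite, and its terms
  tend to 0.\<close>

lemma strong_law_fourth_moment:
  fixes Y :: "nat \<Rightarrow> 'a \<Rightarrow> real"
  assumes indep: "indep_vars (\<lambda>_. borel) Y UNIV"
    and int: "\<And>i. integrable M (\<lambda>\<omega>. Y i \<omega> ^ 4)"
    and mean: "\<And>i. expectation (Y i) = 0"
    and kurt: "\<And>i. expectation (\<lambda>\<omega>. Y i \<omega> ^ 4) \<le> \<kappa>"
  shows "AE \<omega> in M. (\<lambda>n. (\<Sum>i<n. Y i \<omega>) / n) \<longlonglongrightarrow> 0"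
proof -
  have Y[measurable]: "random_variable borel (Y i)" for i
    using indep by (auto simp: indep_vars_def)
  have var: "expectation (\<lambda>\<omega>. Y i \<omega> ^ 2) \<le> 1 + \<kappa>" for i
  proof -
    have "expectation (\<lambda>\<omega>. Y i \<omega> ^ 2) \<le> expectation (\<lambda>\<omega>. 1 + Y i \<omega> ^ 4)"
      using power_le_1_plus_power4[of 2] int integrable_power_le4[OF Y int, of 2]
      by (intro integral_mono) auto
    also have "\<dots> \<le> 1 + \<kappa>" using int kurt by (simp add: prob_space)
    finally show ?thesis .
  qed
  have \<kappa>: "0 \<le> \<kappa>" by (rule order_trans[OF _ kurt[of 0]]) simp
  define C where "C = \<kappa> + 3 * (1 + \<kappa>)\<^sup>2"
  have C: "0 \<le> C" unfolding C_def using \<kappa> by simp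
  define Z where "Z n \<omega> = ((\<Sum>i<n. Y i \<omega>) / n) ^ 4" for n \<omega>
  note S = fourth_moment_sum_bound[OF indep int mean var kurt]
  have intZ: "integrable M (Z n)" and EZ: "expectation (Z n) \<le> C * (1 / real n ^ 2)" for n
  proof -
    show "integrable M (Z n)" unfolding Z_def using S[of n] by (simp add: power_divide)
    show "expectation (Z n) \<le> C * (1 / real n ^ 2)"
    proof (cases "n = 0")
      case False
      have "expectation (Z n) = expectation (\<lambda>\<omega>. (\<Sum>i<n. Y i \<omega>) ^ 4) / n ^ 4"
        unfolding Z_def by (simp add: power_divide)
      also have "\<dots> \<le> (n * \<kappa> + 3 * (real n)\<^sup>2 * (1 + \<kappa>)\<^sup>2) / n ^ 4"
        using S[of n] by (intro divide_right_mono) auto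
      also have "\<dots> \<le> ((real n)\<^sup>2 * \<kappa> + 3 * (real n)\<^sup>2 * (1 + \<kappa>)\<^sup>2) / n ^ 4"
      proof -
        have "real n \<le> (real n)\<^sup>2" using False by (simp add: power2_eq_square)
        then show ?thesis using \<kappa> by (intro divide_right_mono add_mono mult_right_mono) auto
      qed
      also have "\<dots> = C * (1 / real n ^ 2)"
        using False unfolding C_def by (simp add: field_simps power2_eq_square power4_eq_xxxx)
      finally show ?thesis .
    next
      \<comment> \<open>Division by 0 gives 0, so both the empty average and the bound vanish at
        \<open>n = 0\<close>.\<close>
      case True
      then have "Z n = (\<lambda>_. 0)" by (auto simp: Z_def)
      then show ?thesis using True by simp
    qed
  qed
  \<comment> \<open>Extended nonnegative integrals allow sum and integral to be exchanged before
    finiteness is known.\<close>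
  have "(\<integral>\<^sup>+\<omega>. (\<Sum>n. ennreal (Z n \<omega>)) \<partial>M) = (\<Sum>n. \<integral>\<^sup>+\<omega>. ennreal (Z n \<omega>) \<partial>M)"
    unfolding Z_def by (intro nn_integral_suminf) measurable
  also have "\<dots> = (\<Sum>n. ennreal (expectation (Z n)))"
    using intZ by (subst nn_integral_eq_integral) (auto simp: Z_def)
  also have "\<dots> \<le> (\<Sum>n. ennreal (C * (1 / real n ^ 2)))"
    by (intro suminf_le ennreal_leI EZ) auto
  also have "\<dots> < \<infinity>"
  proof -
    have "summable (\<lambda>n. C * (1 / real n ^ 2))"
      using inverse_power_summable[of 2] by (intro summable_mult) (simp add: inverse_eq_divide)
    then show ?thesis using C by (subst suminf_ennreal2) auto
  qed
  finally have fin: "(\<integral>\<^sup>+\<omega>. (\<Sum>n. ennreal (Z n \<omega>)) \<partial>M) \<noteq> \<infinity>" by simp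
  have "AE \<omega> in M. (\<Sum>n. ennreal (Z n \<omega>)) \<noteq> \<infinity>"
    by (rule nn_integral_PInf_AE[OF _ fin]) (unfold Z_def, measurable)
  then show ?thesis
  proof eventually_elim
    case (elim \<omega>)
    have "summable (\<lambda>n. Z n \<omega>)"
      using elim by (intro summable_suminf_not_top) (auto simp: Z_def)
    then have "(\<lambda>n. Z n \<omega>) \<longlonglongrightarrow> 0" by (rule summable_LIMSEQ_zero)
    then have "(\<lambda>n. root 4 (Z n \<omega>)) \<longlonglongrightarrow> root 4 0" by (intro tendsto_intros)
    moreover have "root 4 (Z n \<omega>) = \<bar>(\<Sum>i<n. Y i \<omega>) / n\<bar>" for n
      unfolding Z_def using real_root_power_cancel[of 4 "\<bar>(\<Sum>i<n. Y i \<omega>) / n\<bar>"] by (simp only: power_even_abs_numeral even_numeral)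
    ultimately show ?case by (simp del: abs_divide) (rule tendsto_rabs_zero_cancel)
  qed
qed

end

section \<open>Identifiability of Gaussian mixtures\<close>

lemma exp_quadratic_tendsto_0:
  fixes a b c :: real
  assumes "a < 0 \<or> a = 0 \<and> b < 0"
  shows "((\<lambda>x. exp (a * x\<^sup>2 + b * x + c)) \<longlongrightarrow> 0) at_top"
proof -
  have "filterlim (\<lambda>x. a * x\<^sup>2 + b * x + c) at_bot at_top"
  proof (cases "a = 0")
    case True
    then have "b < 0" using assms by auto
    then show ?thesis using True by simp real_asymp
  next
    case False
    then have "a < 0" using assms by auto
    then show ?thesis by real_asymp
  qed
  then show ?thesis by (rule filterlim_compose[OF exp_at_bot])
qed

lemma normal_density_exp:
  "normal_density \<mu> (exp t) x = exp (- (x - \<mu>)\<^sup>2 * exp (-2 * t) / 2 - t) / sqrt (2 * pi)"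
proof -
  have "sqrt (2 * pi * (exp t)\<^sup>2) = sqrt (2 * pi) * exp t"
    by (simp add: real_sqrt_mult)
  moreover have "- (x - \<mu>)\<^sup>2 / (2 * (exp t)\<^sup>2) = - (x - \<mu>)\<^sup>2 * exp (-2 * t) / 2"
    by (simp add: exp_minus exp_double inverse_eq_divide)
  ultimately show ?thesis
    unfolding normal_density_def by (simp only: exp_diff) simp
qed

text \<open>The logarithm of the ratio is a quadratic polynomial in \<open>x\<close>. Its leading
  coefficient is negative if \<open>t < t'\<close>; if \<open>t = t'\<close> it vanishes and the
  linear coefficient has the sign of \<open>\<mu> - \<mu>'\<close>.\<close>

lemma normal_density_ratio_tendsto_0:
  assumes "t < t' \<or> t = t' \<and> \<mu> < \<mu>'"
  shows "((\<lambda>x. normal_density \<mu> (exp t) x / normal_density \<mu>' (exp t') x) \<longlongrightarrow> 0) at_top"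
proof -
  let ?s = "exp (-2 * t)" and ?s' = "exp (-2 * t')"
  have "normal_density \<mu> (exp t) x / normal_density \<mu>' (exp t') x
      = exp ((?s' - ?s) / 2 * x\<^sup>2 + (\<mu> * ?s - \<mu>' * ?s') * x
          + (\<mu>'\<^sup>2 * ?s' / 2 + t' - \<mu>\<^sup>2 * ?s / 2 - t))" for x
    unfolding normal_density_exp
    by (simp add: exp_diff[symmetric]) (simp add: power2_eq_square field_simps)
  moreover have "(?s' - ?s) / 2 < 0 \<or> (?s' - ?s) / 2 = 0 \<and> \<mu> * ?s - \<mu>' * ?s' < 0"
    using assms by auto
  ultimately show ?thesis by (simp only: exp_quadratic_tendsto_0)
qed

text \<open>The component with the largest variance and, among those, the largest mean dominates all
  others at \<open>+\<infinity>\<close>, so its coefficient must vanish.\<close>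

lemma normal_density_lin_indep:
  fixes P :: "(real \<times> real) set" and c :: "real \<times> real \<Rightarrow> real"
  assumes "finite P" and "\<And>x. (\<Sum>p\<in>P. c p * normal_density (fst p) (exp (snd p)) x) = 0"
    and "p \<in> P"
  shows "c p = 0"
  using assms
proof (induction "card P" arbitrary: P p)
  case 0
  then show ?case by simp
next
  case (Suc n)
  define T where "T = Max (snd ` P)"
  define U where "U = Max (fst ` {p \<in> P. snd p = T})"
  have T: "T \<in> snd ` P" "\<And>p. p \<in> P \<Longrightarrow> snd p \<le> T"
    unfolding T_def using Suc.prems by (auto intro!: Max_in)
  have U: "U \<in> fst ` {p \<in> P. snd p = T}" "\<And>p. p \<in> P \<Longrightarrow> snd p = T \<Longrightarrow> fst p \<le> U"
    unfolding U_def using Suc.prems T by (auto intro!: Max_in Max_ge)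
  have q: "(U, T) \<in> P" using U(1) by force
  let ?\<phi> = "\<lambda>p x. normal_density (fst p) (exp (snd p)) x"
  \<comment> \<open>After division by the dominant density, the sum that is identically 0 converges
    to \<open>c (U, T)\<close>. The induction hypothesis then handles the remaining pairs.\<close>
  have "((\<lambda>x. \<Sum>p\<in>P. c p * (?\<phi> p x / ?\<phi> (U, T) x)) \<longlongrightarrow> (\<Sum>p\<in>P. c p * (if p = (U, T) then 1 else 0))) at_top"
  proof (intro tendsto_sum tendsto_mult_left)
    fix p assume p: "p \<in> P"
    show "((\<lambda>x. ?\<phi> p x / ?\<phi> (U, T) x) \<longlongrightarrow> (if p = (U, T) then 1 else 0)) at_top"
    proof (cases "p = (U, T)")
      case True
      have "normal_density U (exp T) x \<noteq> 0" for x
        using normal_density_pos[of "exp T" U x] by simp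
      then show ?thesis using True by simp
    next
      case False
      then have "snd p < T \<or> snd p = T \<and> fst p < U"
        using T(2)[OF p] U(2)[OF p] by (cases p) force
      then show ?thesis using False normal_density_ratio_tendsto_0 by simp
    qed
  qed
  moreover have "(\<Sum>p\<in>P. c p * (?\<phi> p x / ?\<phi> (U, T) x)) = 0" for x
    using Suc.prems(2)[of x] by (simp add: sum_divide_distrib[symmetric])
  moreover have "(\<Sum>p\<in>P. c p * (if p = (U, T) then 1 else 0)) = c (U, T)"
    using q Suc.prems(1) by (simp add: if_distrib cong: if_cong)
  ultimately have c0: "c (U, T) = 0"
    by (simp add: tendsto_const_iff)
  show ?case
  proof (cases "p = (U, T)")
    case False
    show ?thesis
    proof (rule Suc.hyps(1)[of "P - {(U, T)}"])
      show "n = card (P - {(U, T)})" using Suc.hyps(2) q Suc.prems(1) by simp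
      show "(\<Sum>p\<in>P - {(U, T)}. c p * ?\<phi> p x) = 0" for x
        using Suc.prems(1) Suc.prems(2)[of x] q c0 by (simp add: sum.remove)
    qed (use Suc.prems False in auto)
  qed (use c0 in simp)
qed

text \<open>Linear independence equates the total weights that the two mixtures give to each pair of
  mean and log standard deviation. The unprimed mixture may a priori repeat components; positivity
  of \<open>p'\<close> makes every primed component occur in it, and counting then rules out
  repetitions.\<close>

lemma mixture_identifiable:
  fixes p \<mu> t p' \<mu>' t' :: "real ^ 'k"
  assumes eq: "\<And>x. mixture_density (p, \<mu>, t) x = mixture_density (p', \<mu>', t') x"
    and pos: "\<And>j. 0 < p' $ j"
    and dist: "\<And>j l. j \<noteq> l \<Longrightarrow> (\<mu>' $ j, t' $ j) \<noteq> (\<mu>' $ l, t' $ l)"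
  obtains \<tau> where "\<tau> permutes UNIV" "(p, \<mu>, t) = perm_act \<tau> (p', \<mu>', t')"
proof -
  define a where "a j = (\<mu> $ j, t $ j)" for j
  define b where "b j = (\<mu>' $ j, t' $ j)" for j
  have b: "inj b" using dist by (auto simp: inj_def b_def)
  let ?\<phi> = "\<lambda>q x. normal_density (fst q) (exp (snd q)) x"
  define P where "P = range a \<union> range b"
  \<comment> \<open>Coefficient of the density with parameters \<open>q\<close> in the difference of
    the two mixtures, after merging equal components.\<close>
  define c where "c q = (\<Sum>j | a j = q. p $ j) - (\<Sum>j | b j = q. p' $ j)" for q
  have fin: "finite P" by (simp add: P_def)
  have grp: "(\<Sum>q\<in>P. (\<Sum>j | g j = q. w $ j) * ?\<phi> q x) = (\<Sum>j\<in>UNIV. w $ j * ?\<phi> (g j) x)"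
    if "range g \<subseteq> P" for g :: "'k \<Rightarrow> _" and w :: "real ^ 'k" and x
  proof -
    have "(\<Sum>q\<in>P. (\<Sum>j | g j = q. w $ j) * ?\<phi> q x) = (\<Sum>q\<in>P. \<Sum>j | j \<in> UNIV \<and> g j = q. w $ j * ?\<phi> (g j) x)"
      by (intro sum.cong refl) (simp add: sum_distrib_right)
    also have "\<dots> = (\<Sum>j\<in>UNIV. w $ j * ?\<phi> (g j) x)"
      by (rule sum.group) (use fin that in auto)
    finally show ?thesis .
  qed
  have "(\<Sum>q\<in>P. c q * ?\<phi> q x) = 0" for x
    using eq[of x] grp[of a p x] grp[of b p' x]
    by (simp add: c_def left_diff_distrib sum_subtractf mixture_density_def P_def a_def b_def)
  then have c: "c q = 0" if "q \<in> P" for q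
    using normal_density_lin_indep[OF fin, of c] that by simp
  have b_sing: "{l. b l = b j} = {j}" for j using b by (auto simp: inj_def)
  have sum_a: "(\<Sum>i | a i = b j. p $ i) = p' $ j" for j
    using c[of "b j"] by (simp add: c_def P_def b_sing)
  have "range b \<subseteq> range a"
  proof (rule image_subsetI)
    fix j show "b j \<in> range a"
    proof (rule ccontr)
      assume "b j \<notin> range a"
      then have "{i. a i = b j} = {}" by (metis (mono_tags, lifting) Collect_empty_eq rangeI)
      then show False using sum_a[of j] pos[of j] by simp
    qed
  qed
  \<comment> \<open>A set of at most \<open>CARD('k)\<close> elements contains one of exactly that
    size, so the ranges agree and \<open>a\<close> is injective.\<close>
  moreover have "card (range b) = CARD('k)" using b by (simp add: card_image)
  moreover have "card (range a) \<le> CARD('k)" by (simp add: card_image_le)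
  ultimately have ran: "range b = range a" and "card (range a) = CARD('k)"
    by (metis card_seteq finite_imageI finite)+
  then have a: "inj a" by (simp add: eq_card_imp_inj_on)
  define \<sigma> where "\<sigma> j = inv b (a j)" for j
  have b\<sigma>: "b (\<sigma> j) = a j" for j
    unfolding \<sigma>_def by (rule f_inv_into_f) (use ran in auto)
  have "inj \<sigma>" using a b\<sigma> by (metis injD injI)
  then have bij: "bij \<sigma>" by (simp add: bij_def finite_UNIV_inj_surj)
  then have per: "\<sigma> permutes UNIV" by (rule bij_imp_permutes) simp
  have "p $ j = p' $ \<sigma> j" for j
  proof -
    have "{i. a i = b (\<sigma> j)} = {j}" using a b\<sigma> by (auto simp: inj_def)
    then show ?thesis using sum_a[of "\<sigma> j"] by simp
  qed
  moreover have "\<mu> $ j = \<mu>' $ \<sigma> j" "t $ j = t' $ \<sigma> j" for j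
    using b\<sigma>[of j] by (auto simp: a_def b_def)
  \<comment> \<open>The action permutes indices by the inverse, so the witness is
    \<open>inv \<sigma>\<close> and not \<open>\<sigma>\<close>.\<close>
  ultimately have "(p, \<mu>, t) = perm_act (inv \<sigma>) (p', \<mu>', t')"
    using bij by (simp add: perm_act_def vec_eq_iff inv_inv_eq)
  with permutes_inv[OF per] show ?thesis by (rule that)
qed

section \<open>Regularity of the mixture density on the sieve\<close>

lemma sieveD:
  assumes "(p, \<mu>, t) \<in> sieve m \<epsilon>"
  shows "\<epsilon> \<le> p $ j" "\<bar>\<mu> $ j\<bar> \<le> m" "\<bar>t $ j\<bar> \<le> m" "(\<Sum>j\<in>UNIV. p $ j) = 1"
  using assms by (auto simp: sieve_def prob_simplex_def abs_le_iff minus_le_iff)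

text \<open>A mean value bound, obtained from 1 + u \<le> exp u without differentiation.\<close>

lemma abs_exp_diff_le:
  fixes a b c :: real
  assumes "a \<le> c" "b \<le> c"
  shows "\<bar>exp a - exp b\<bar> \<le> exp c * \<bar>a - b\<bar>"
proof -
  have *: "exp u - exp v \<le> exp c * \<bar>u - v\<bar>" if "u \<le> c" for u v :: real
  proof -
    have "exp u - exp v = exp u * (1 - exp (v - u))" by (simp add: exp_diff field_simps)
    also have "\<dots> \<le> exp u * \<bar>u - v\<bar>"
      using exp_ge_add_one_self[of "v - u"] abs_ge_self[of "u - v"]
      by (intro mult_left_mono exp_ge_zero) linarith
    also have "\<dots> \<le> exp c * \<bar>u - v\<bar>" using that by (intro mult_right_mono) auto
    finally show ?thesis .
  qed
  show ?thesis using *[OF assms(1), of b] *[OF assms(2), of a] by (auto simp: abs_le_iff abs_minus_commute)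
qed

text \<open>The change of the log density is at most quadratic in \<open>x\<close> and linear in the
  change of the parameters: both variances and means stay in a bounded range, and the variances away
  from 0.\<close>

lemma normal_density_le_exp:
  fixes m \<mu> \<mu>' t t' x :: real
  assumes m: "1 \<le> m" and b: "\<bar>\<mu>\<bar> \<le> m" "\<bar>\<mu>'\<bar> \<le> m" "\<bar>t\<bar> \<le> m" "\<bar>t'\<bar> \<le> m"
  shows "normal_density \<mu>' (exp t') x \<le> normal_density \<mu> (exp t) x
    * exp ((2 * m\<^sup>2 * exp (2 * m) + 1) * (1 + x\<^sup>2) * (\<bar>\<mu> - \<mu>'\<bar> + \<bar>t - t'\<bar>))"
proof -
  define E where "E = exp (2 * m)"
  \<comment> \<open>As \<open>1 \<le> m\<close>, this one quantity dominates both
    \<open>\<bar>x\<bar> + m\<close> and its square.\<close>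
  define A where "A = 2 * m\<^sup>2 * (1 + x\<^sup>2)"
  have E: "0 < E" "exp (-2 * t) \<le> E" using b by (auto simp: E_def)
  have xm: "(\<bar>x\<bar> + m)\<^sup>2 \<le> A"
  proof -
    have "(\<bar>x\<bar> + m)\<^sup>2 \<le> 2 * x\<^sup>2 + 2 * m\<^sup>2"
      using zero_le_power2[of "\<bar>x\<bar> - m"] by (simp add: power2_eq_square algebra_simps)
    also have "\<dots> \<le> A"
    proof -
      have "1 * x\<^sup>2 \<le> m\<^sup>2 * x\<^sup>2" using m by (intro mult_right_mono) auto
      then show ?thesis by (simp add: A_def algebra_simps)
    qed
    finally show ?thesis .
  qed
  have A: "0 \<le> A" by (simp add: A_def)
  have xm': "\<bar>x\<bar> + m \<le> A"
  proof -
    have "(\<bar>x\<bar> + m) * 1 \<le> (\<bar>x\<bar> + m) * (\<bar>x\<bar> + m)" using m by (intro mult_left_mono) auto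
    then show ?thesis using xm by (simp add: power2_eq_square)
  qed
  have 1: "((x - \<mu>)\<^sup>2 - (x - \<mu>')\<^sup>2) * exp (-2 * t) \<le> (2 * A * \<bar>\<mu> - \<mu>'\<bar>) * E"
  proof -
    have "(x - \<mu>)\<^sup>2 - (x - \<mu>')\<^sup>2 = (\<mu>' - \<mu>) * (2 * x - \<mu> - \<mu>')"
      by (simp add: power2_eq_square algebra_simps)
    then have "\<bar>(x - \<mu>)\<^sup>2 - (x - \<mu>')\<^sup>2\<bar> = \<bar>\<mu> - \<mu>'\<bar> * \<bar>2 * x - \<mu> - \<mu>'\<bar>"
      by (simp add: abs_mult abs_minus_commute)
    also have "\<dots> \<le> \<bar>\<mu> - \<mu>'\<bar> * (2 * A)" using b xm' by (intro mult_left_mono) auto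
    finally have *: "\<bar>(x - \<mu>)\<^sup>2 - (x - \<mu>')\<^sup>2\<bar> \<le> 2 * A * \<bar>\<mu> - \<mu>'\<bar>" by (simp add: mult_ac)
    have "((x - \<mu>)\<^sup>2 - (x - \<mu>')\<^sup>2) * exp (-2 * t) \<le> \<bar>(x - \<mu>)\<^sup>2 - (x - \<mu>')\<^sup>2\<bar> * exp (-2 * t)"
      by (intro mult_right_mono) auto
    also have "\<dots> \<le> (2 * A * \<bar>\<mu> - \<mu>'\<bar>) * E" using * E A by (intro mult_mono) auto
    finally show ?thesis .
  qed
  have 2: "(x - \<mu>')\<^sup>2 * (exp (-2 * t) - exp (-2 * t')) \<le> A * (E * (2 * \<bar>t - t'\<bar>))"
  proof -
    have "\<bar>x - \<mu>'\<bar> \<le> \<bar>x\<bar> + m" using b by auto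
    then have "\<bar>x - \<mu>'\<bar>\<^sup>2 \<le> (\<bar>x\<bar> + m)\<^sup>2" by (intro power_mono) auto
    then have *: "(x - \<mu>')\<^sup>2 \<le> A" using xm by simp
    have "\<bar>exp (-2 * t) - exp (-2 * t')\<bar> \<le> E * \<bar>-2 * t - (-2 * t')\<bar>"
      unfolding E_def using b by (intro abs_exp_diff_le) auto
    also have "\<bar>-2 * t - (-2 * t')\<bar> = 2 * \<bar>t - t'\<bar>" by (simp add: abs_if)
    finally have **: "\<bar>exp (-2 * t) - exp (-2 * t')\<bar> \<le> E * (2 * \<bar>t - t'\<bar>)" .
    have "(x - \<mu>')\<^sup>2 * (exp (-2 * t) - exp (-2 * t')) \<le> (x - \<mu>')\<^sup>2 * \<bar>exp (-2 * t) - exp (-2 * t')\<bar>"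
      by (intro mult_left_mono) auto
    also have "\<dots> \<le> A * (E * (2 * \<bar>t - t'\<bar>))" using * ** A by (intro mult_mono) auto
    finally show ?thesis .
  qed
  have 3: "t - t' \<le> (1 + x\<^sup>2) * (\<bar>\<mu> - \<mu>'\<bar> + \<bar>t - t'\<bar>)"
  proof -
    have "t - t' \<le> 1 * (\<bar>\<mu> - \<mu>'\<bar> + \<bar>t - t'\<bar>)" by auto
    also have "\<dots> \<le> (1 + x\<^sup>2) * (\<bar>\<mu> - \<mu>'\<bar> + \<bar>t - t'\<bar>)" by (intro mult_right_mono) auto
    finally show ?thesis .
  qed
  let ?h = "\<lambda>\<mu> t. - (x - \<mu>)\<^sup>2 * exp (-2 * t) / 2 - t"
  let ?L = "(2 * m\<^sup>2 * exp (2 * m) + 1) * (1 + x\<^sup>2) * (\<bar>\<mu> - \<mu>'\<bar> + \<bar>t - t'\<bar>)"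
  \<comment> \<open>The mean is changed first, with \<open>t\<close> fixed, and then
    \<open>t\<close>, with mean \<open>\<mu>'\<close>; the last summand comes from the normalizing
    factor.\<close>
  have "?h \<mu>' t' - ?h \<mu> t = (((x - \<mu>)\<^sup>2 - (x - \<mu>')\<^sup>2) * exp (-2 * t)
      + (x - \<mu>')\<^sup>2 * (exp (-2 * t) - exp (-2 * t'))) / 2 + (t - t')"
    by (simp add: field_simps)
  also have "\<dots> \<le> ((2 * A * \<bar>\<mu> - \<mu>'\<bar>) * E + A * (E * (2 * \<bar>t - t'\<bar>))) / 2
      + (1 + x\<^sup>2) * (\<bar>\<mu> - \<mu>'\<bar> + \<bar>t - t'\<bar>)"
    using 1 2 3 by (intro add_mono divide_right_mono) auto
  also have "\<dots> = ?L" by (simp add: A_def E_def field_simps)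
  finally have "exp (?h \<mu>' t') \<le> exp (?h \<mu> t + ?L)" by simp
  then show ?thesis
    unfolding normal_density_exp by (simp add: exp_add divide_right_mono)
qed

text \<open>Comparing the mixtures term by term, as ratios, avoids differentiating the logarithm of the sum.\<close>

lemma mixture_density_le_exp:
  fixes \<theta> \<theta>' :: "'k::finite param"
  assumes m: "1 \<le> m" and \<epsilon>: "0 < \<epsilon>" and \<theta>: "\<theta> \<in> sieve m \<epsilon>" "\<theta>' \<in> sieve m \<epsilon>"
  shows "mixture_density \<theta>' x \<le> mixture_density \<theta> x
    * exp ((1 / \<epsilon> + 2 * (2 * m\<^sup>2 * exp (2 * m) + 1)) * (1 + x\<^sup>2) * norm (\<theta> - \<theta>'))"
proof -
  obtain p \<mu> t p' \<mu>' t' where eq: "\<theta> = (p, \<mu>, t)" "\<theta>' = (p', \<mu>', t')"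
    by (metis prod_cases3)
  note S = sieveD[OF \<theta>(1)[unfolded eq]] and S' = sieveD[OF \<theta>(2)[unfolded eq]]
  define N where "N = norm (\<theta> - \<theta>')"
  define K where "K = 2 * m\<^sup>2 * exp (2 * m) + 1"
  have K: "0 \<le> K" by (simp add: K_def)
  have N: "\<bar>p $ j - p' $ j\<bar> \<le> N" "\<bar>\<mu> $ j - \<mu>' $ j\<bar> \<le> N" "\<bar>t $ j - t' $ j\<bar> \<le> N" for j
  proof -
    have 1: "norm (p - p') \<le> N" "norm (\<mu> - \<mu>', t - t') \<le> N"
      using norm_fst_le[of "p - p'" "(\<mu> - \<mu>', t - t')"] norm_snd_le[of "(\<mu> - \<mu>', t - t')" "p - p'"]
      by (simp_all add: N_def eq)
    then have 2: "norm (\<mu> - \<mu>') \<le> N" "norm (t - t') \<le> N"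
      using norm_fst_le[of "\<mu> - \<mu>'" "t - t'"] norm_snd_le[of "t - t'" "\<mu> - \<mu>'"] by simp_all
    show "\<bar>p $ j - p' $ j\<bar> \<le> N" "\<bar>\<mu> $ j - \<mu>' $ j\<bar> \<le> N" "\<bar>t $ j - t' $ j\<bar> \<le> N"
      using 1 2 component_le_norm_cart[of "p - p'" j] component_le_norm_cart[of "\<mu> - \<mu>'" j]
        component_le_norm_cart[of "t - t'" j] by simp_all
  qed
  have N0: "0 \<le> N" by (simp add: N_def)
  have "p' $ j * normal_density (\<mu>' $ j) (exp (t' $ j)) x
      \<le> p $ j * normal_density (\<mu> $ j) (exp (t $ j)) x * exp ((1 / \<epsilon> + 2 * K) * (1 + x\<^sup>2) * N)" for j
  proof -
    have pj: "0 < p $ j" using S(1)[of j] \<epsilon> by simp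
    \<comment> \<open>The lower bound \<open>\<epsilon>\<close> on the weights turns an additive
      error into a multiplicative one, whence the \<open>1 / \<epsilon>\<close> in the
      constant.\<close>
    have "p' $ j \<le> p $ j + N" using N(1)[of j] by auto
    also have "\<dots> = p $ j * (1 + N / p $ j)" using pj by (simp add: field_simps)
    also have "\<dots> \<le> p $ j * (1 + N / \<epsilon>)"
      using pj S(1)[of j] \<epsilon> N0 by (intro mult_left_mono add_left_mono divide_left_mono) auto
    also have "\<dots> \<le> p $ j * exp (N / \<epsilon>)"
      using pj by (intro mult_left_mono exp_ge_add_one_self) auto
    finally have w: "p' $ j \<le> p $ j * exp (N / \<epsilon>)" .
    have "normal_density (\<mu>' $ j) (exp (t' $ j)) x \<le> normal_density (\<mu> $ j) (exp (t $ j)) x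
        * exp (K * (1 + x\<^sup>2) * (\<bar>\<mu> $ j - \<mu>' $ j\<bar> + \<bar>t $ j - t' $ j\<bar>))"
      unfolding K_def using m S S' by (intro normal_density_le_exp) auto
    also have "\<dots> \<le> normal_density (\<mu> $ j) (exp (t $ j)) x * exp (K * (1 + x\<^sup>2) * (N + N))"
      using add_mono[OF N(2,3)[of j]] K
      by (intro mult_left_mono normal_density_nonneg) (simp add: mult_left_mono)
    finally have d: "normal_density (\<mu>' $ j) (exp (t' $ j)) x
        \<le> normal_density (\<mu> $ j) (exp (t $ j)) x * exp (K * (1 + x\<^sup>2) * (N + N))" .
    have "N / \<epsilon> + K * (1 + x\<^sup>2) * (N + N) \<le> (1 / \<epsilon> + 2 * K) * (1 + x\<^sup>2) * N"
      using N0 \<epsilon> by (simp add: field_simps)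
    then have e: "exp (N / \<epsilon>) * exp (K * (1 + x\<^sup>2) * (N + N)) \<le> exp ((1 / \<epsilon> + 2 * K) * (1 + x\<^sup>2) * N)"
      by (simp add: exp_add[symmetric])
    have "p' $ j * normal_density (\<mu>' $ j) (exp (t' $ j)) x
        \<le> (p $ j * exp (N / \<epsilon>)) * (normal_density (\<mu> $ j) (exp (t $ j)) x * exp (K * (1 + x\<^sup>2) * (N + N)))"
      using w d pj by (intro mult_mono) auto
    also have "\<dots> = p $ j * normal_density (\<mu> $ j) (exp (t $ j)) x
        * (exp (N / \<epsilon>) * exp (K * (1 + x\<^sup>2) * (N + N)))" by (simp add: mult_ac)
    also have "\<dots> \<le> p $ j * normal_density (\<mu> $ j) (exp (t $ j)) x * exp ((1 / \<epsilon> + 2 * K) * (1 + x\<^sup>2) * N)"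
      using e pj by (intro mult_left_mono) auto
    finally show ?thesis .
  qed
  then show ?thesis
    unfolding N_def K_def eq mixture_density_def by (simp add: sum_distrib_right sum_mono)
qed

lemma mixture_density_pos:
  assumes "0 < \<epsilon>" "\<theta> \<in> sieve m \<epsilon>"
  shows "0 < mixture_density \<theta> x"
proof -
  obtain p \<mu> t where eq: "\<theta> = (p, \<mu>, t)" by (metis prod_cases3)
  have "0 < p $ j" for j using sieveD(1)[OF assms(2)[unfolded eq], of j] assms(1) by simp
  then show ?thesis
    by (auto simp: eq mixture_density_def intro!: sum_pos mult_pos_pos normal_density_pos)
qed

text \<open>Logarithms turn the multiplicative comparison, used in both directions, into a Lipschitz
  bound. The constant depends on \<open>m\<close> and \<open>\<epsilon>\<close> only, so it serves
  all observations and parameters at once.\<close>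

lemma abs_ln_mixture_density_diff_le:
  fixes m \<epsilon> :: real
  assumes "1 \<le> m" "0 < \<epsilon>"
  obtains C where "0 \<le> C"
    "\<And>\<theta> \<theta>' x. \<theta> \<in> sieve m \<epsilon> \<Longrightarrow> \<theta>' \<in> sieve m \<epsilon> \<Longrightarrow>
      \<bar>ln (mixture_density \<theta>' x) - ln (mixture_density \<theta> x)\<bar> \<le> C * (1 + x\<^sup>2) * norm (\<theta> - \<theta>')"
proof
  define C where "C = 1 / \<epsilon> + 2 * (2 * m\<^sup>2 * exp (2 * m) + 1)"
  show "0 \<le> C" using assms by (simp add: C_def)
  have *: "ln (mixture_density \<theta>' x) - ln (mixture_density \<theta> x) \<le> C * (1 + x\<^sup>2) * norm (\<theta> - \<theta>')"
    if S: "\<theta> \<in> sieve m \<epsilon>" "\<theta>' \<in> sieve m \<epsilon>" for \<theta> \<theta>' :: "'k::finite param" and x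
  proof -
    note pos = mixture_density_pos[OF assms(2) S(1), of x] mixture_density_pos[OF assms(2) S(2), of x]
    have "mixture_density \<theta>' x \<le> mixture_density \<theta> x * exp (C * (1 + x\<^sup>2) * norm (\<theta> - \<theta>'))"
      unfolding C_def by (rule mixture_density_le_exp[OF assms S])
    then have "ln (mixture_density \<theta>' x)
        \<le> ln (mixture_density \<theta> x * exp (C * (1 + x\<^sup>2) * norm (\<theta> - \<theta>')))"
      using pos by simp
    also have "\<dots> = ln (mixture_density \<theta> x) + C * (1 + x\<^sup>2) * norm (\<theta> - \<theta>')"
      using pos by (simp add: ln_mult)
    finally show ?thesis by simp
  qed
  show "\<bar>ln (mixture_density \<theta>' x) - ln (mixture_density \<theta> x)\<bar> \<le> C * (1 + x\<^sup>2) * norm (\<theta> - \<theta>')"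
    if S: "\<theta> \<in> sieve m \<epsilon>" "\<theta>' \<in> sieve m \<epsilon>" for \<theta> \<theta>' :: "'k::finite param" and x
    using *[OF S, of x] *[OF S(2,1), of x] by (simp add: abs_le_iff norm_minus_commute)
qed

section \<open>Continuity and moments of the mixture density\<close>

lemma mixture_density_continuous [continuous_intros]: "continuous_on A (mixture_density \<theta>)"
proof -
  obtain p \<mu> t where eq: "\<theta> = (p, \<mu>, t)" by (metis prod_cases3)
  show ?thesis unfolding eq mixture_density_def normal_density_def
    by (auto intro!: continuous_intros)
qed

lemma mixture_density_measurable [measurable]: "mixture_density \<theta> \<in> borel_measurable borel"
  by (intro borel_measurable_continuous_onI mixture_density_continuous)

text \<open>The binomial expansion of \<open>x = (x - \<mu>) + \<mu>\<close> reduces raw moments to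
  central ones.\<close>

lemma integrable_normal_density_power:
  assumes "0 < \<sigma>"
  shows "integrable lborel (\<lambda>x. normal_density \<mu> \<sigma> x * x ^ n)"
proof -
  have "normal_density \<mu> \<sigma> x * x ^ n
      = (\<Sum>k\<le>n. (real (n choose k) * \<mu> ^ (n - k)) * (normal_density \<mu> \<sigma> x * (x - \<mu>) ^ k))" for x
    using binomial_ring[of "x - \<mu>" \<mu> n] by (simp add: sum_distrib_left mult_ac)
  then show ?thesis
    by (simp only:) (intro Bochner_Integration.integrable_sum integrable_mult_right integrable_normal_moment assms)
qed

lemma integrable_mixture_density_power: "integrable lborel (\<lambda>x. mixture_density \<theta> x * x ^ n)"
proof -
  obtain p \<mu> t where eq: "\<theta> = (p, \<mu>, t)" by (metis prod_cases3)
  have "mixture_density \<theta> x * x ^ n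
      = (\<Sum>j\<in>UNIV. p $ j * (normal_density (\<mu> $ j) (exp (t $ j)) x * x ^ n))" for x
    by (simp add: eq mixture_density_def sum_distrib_right mult.assoc)
  then show ?thesis by (simp add: integrable_normal_density_power)
qed

lemma integral_mixture_density:
  assumes "\<theta> \<in> sieve m \<epsilon>"
  shows "(\<integral>x. mixture_density \<theta> x \<partial>lborel) = 1"
proof -
  obtain p \<mu> t where eq: "\<theta> = (p, \<mu>, t)" by (metis prod_cases3)
  show ?thesis using sieveD(4)[OF assms[unfolded eq]] by (simp add: eq mixture_density_def)
qed

text \<open>All moments of the mixture exist. Exponent 1 serves log-likelihood ratios, exponent 4
  their fourth moments.\<close>

lemma integrable_mixture_density_mult:
  assumes [measurable]: "g \<in> borel_measurable borel" and g: "\<And>x. \<bar>g x\<bar> \<le> C * (1 + x\<^sup>2) ^ n"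
  shows "integrable lborel (\<lambda>x. mixture_density \<theta> x * g x)"
proof (rule Bochner_Integration.integrable_bound)
  have "mixture_density \<theta> x * (C * (1 + x\<^sup>2) ^ n)
      = (\<Sum>k\<le>n. C * real (n choose k) * (mixture_density \<theta> x * x ^ (2 * (n - k))))" for x
    using binomial_ring[of 1 "x\<^sup>2" n] by (simp add: sum_distrib_left mult_ac flip: power_mult)
  then show "integrable lborel (\<lambda>x. mixture_density \<theta> x * (C * (1 + x\<^sup>2) ^ n))"
    by (simp add: integrable_mixture_density_power)
  show "AE x in lborel. norm (mixture_density \<theta> x * g x) \<le> norm (mixture_density \<theta> x * (C * (1 + x\<^sup>2) ^ n))"

  proof (rule AE_I2)
    fix x
    have "\<bar>g x\<bar> \<le> \<bar>C * (1 + x\<^sup>2) ^ n\<bar>" using g[of x] by linarith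
    then show "norm (mixture_density \<theta> x * g x) \<le> norm (mixture_density \<theta> x * (C * (1 + x\<^sup>2) ^ n))"
      unfolding real_norm_def abs_mult[of "mixture_density \<theta> x"] by (rule mult_left_mono) simp
  qed
qed measurable

section \<open>Gibbs' inequality and compactness\<close>

text \<open>Integrate \<open>ln u \<le> u - 1\<close>, with equality only at \<open>u = 1\<close>, at \<open>u = g x / f x\<close>.\<close>

lemma integral_ln_ratio_neg:
  fixes f g :: "real \<Rightarrow> real"
  assumes cont: "continuous_on UNIV f" "continuous_on UNIV g"
    and pos: "\<And>x. 0 < f x" "\<And>x. 0 < g x"
    and int: "integrable lborel f" "integrable lborel g"
      "integrable lborel (\<lambda>x. f x * (ln (g x) - ln (f x)))"
    and eq: "integral\<^sup>L lborel f = integral\<^sup>L lborel g"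
    and ne: "f \<noteq> g"
  shows "(\<integral>x. f x * (ln (g x) - ln (f x)) \<partial>lborel) < 0"
proof (rule ccontr)
  assume neg: "\<not> ?thesis"
  \<comment> \<open>With \<open>u = g x / f x\<close> this is \<open>f x * (u - 1 - ln u)\<close>,
    hence nonnegative. Because \<open>f\<close> and \<open>g\<close> have equal integrals, the
    negated claim makes its integral nonpositive.\<close>
  define h where "h x = g x - f x - f x * (ln (g x) - ln (f x))" for x
  have h_eq: "h x = f x * (g x / f x - 1 - ln (g x / f x))" for x
    using pos[of x] by (simp add: h_def ln_div field_simps)
  have h0: "0 \<le> h x" for x
    unfolding h_eq using pos[of x] ln_le_minus_one[of "g x / f x"] by simp
  have "integrable lborel h" unfolding h_def using int by simp
  moreover have "integral\<^sup>L lborel h = 0"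
  proof (rule antisym)
    show "integral\<^sup>L lborel h \<le> 0" unfolding h_def using int eq neg by simp
  qed (simp add: h0)
  ultimately have "AE x in lborel. h x = 0"
    using integral_nonneg_eq_0_iff_AE[of lborel h] h0 by simp
  then have "AE x in lebesgue. x \<in> {x. h x = 0}"
    by (simp add: AE_completion)
  \<comment> \<open>A closed set of full Lebesgue measure is the whole line, so continuity upgrades
    almost everywhere to everywhere.\<close>
  moreover have "continuous_on UNIV h"
    unfolding h_def using pos by (intro continuous_intros cont) (auto simp: less_imp_neq[THEN not_sym])
  then have "closed {x. h x = 0}" by (intro closed_Collect_eq continuous_on_const)
  ultimately have "h x = 0" for x using mem_closed_if_AE_lebesgue by blast
  then have "ln (g x / f x) = g x / f x - 1" for x
    using pos(1)[of x] h_eq[of x] by (metis eq_iff_diff_eq_0 less_irrefl mult_eq_0_iff)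
  then have *: "g x / f x = 1" for x by (rule ln_eq_minus_one[rotated]) (use pos[of x] in simp)
  have "f x = g x" for x using *[of x] pos(1)[of x] by (simp add: field_simps)
  then show False using ne by auto
qed

text \<open>The admissible weights form a box cut by a closed hyperplane; means and log standard
  deviations range over boxes.\<close>

lemma compact_sieve:
  assumes "0 \<le> \<epsilon>"
  shows "compact (sieve m \<epsilon> :: 'k::finite param set)"
proof -
  have "{p \<in> prob_simplex. \<epsilon> \<le> (MIN j. p $ j)}
      = cbox (\<chi> j. \<epsilon>) (\<chi> j. 1) \<inter> {p :: real ^ 'k. (\<Sum>j\<in>UNIV. p $ j) = 1}"
    using assms by (auto simp: prob_simplex_def mem_box_cart intro: order_trans)
  moreover have "closed {p :: real ^ 'k. (\<Sum>j\<in>UNIV. p $ j) = 1}"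
    by (intro closed_Collect_eq continuous_intros)
  moreover have "{v :: real ^ 'k. \<forall>j. v $ j \<in> {-m..m}} = cbox (\<chi> j. -m) (\<chi> j. m)"
    by (auto simp: mem_box_cart)
  ultimately show ?thesis
    unfolding sieve_def by (auto intro!: compact_Times compact_Int_closed)
qed

lemma continuous_on_perm_dist:
  fixes \<theta>\<^sub>0 :: "'k::finite param"
  shows "continuous_on A (\<lambda>\<theta>. perm_dist \<theta> \<theta>\<^sub>0)"
proof (rule continuous_onI)
  fix \<theta> :: "'k param" and e :: real
  assume e: "0 < e"
  have le: "perm_dist a b \<le> dist a b" for a b :: "'k param"
    using perm_dist_le[OF permutes_id, of a b] by (simp add: perm_act_id dist_norm)
  have "dist (perm_dist \<theta>' \<theta>\<^sub>0) (perm_dist \<theta> \<theta>\<^sub>0) \<le> dist \<theta>' \<theta>" for \<theta>'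
    using perm_dist_triangle[of \<theta> \<theta>\<^sub>0 \<theta>'] perm_dist_triangle[of \<theta>' \<theta>\<^sub>0 \<theta>] le[of \<theta> \<theta>'] le[of \<theta>' \<theta>]
    by (simp add: dist_real_def dist_commute abs_le_iff)
  then show "\<exists>d>0. \<forall>\<theta>'\<in>A. dist \<theta>' \<theta> < d \<longrightarrow> dist (perm_dist \<theta>' \<theta>\<^sub>0) (perm_dist \<theta> \<theta>\<^sub>0) \<le> e"
    using e by (meson less_imp_le order_trans)
qed

section \<open>Convergence in Hausdorff distance\<close>

text \<open>Bounding all pairwise distances is cruder than the Hausdorff distance requires, but
  costs nothing here because \<open>perm_dist\<close> is constant along an orbit. Non-emptiness
  avoids infinite values of \<open>INF\<close> and \<open>SUP\<close> over the empty set.\<close>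

lemma hausdorff_dist_bounds:
  assumes "A \<noteq> {}" "B \<noteq> {}" and "\<And>a b. a \<in> A \<Longrightarrow> b \<in> B \<Longrightarrow> 0 \<le> d a b \<and> d a b \<le> \<delta>"
  shows "0 \<le> hausdorff_dist d A B" "hausdorff_dist d A B \<le> ereal \<delta>"
proof -
  obtain a b where ab: "a \<in> A" "b \<in> B" using assms by auto
  have "0 \<le> (INF b\<in>B. ereal (d a b))" using assms(3) ab(1) by (intro INF_greatest) auto
  also have "\<dots> \<le> (SUP a\<in>A. INF b\<in>B. ereal (d a b))" using ab(1) by (rule SUP_upper)
  finally show "0 \<le> hausdorff_dist d A B" unfolding hausdorff_dist_def by (simp add: max.coboundedI1)
  show "hausdorff_dist d A B \<le> ereal \<delta>"
    unfolding hausdorff_dist_def using assms(3) ab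
    by (intro max.boundedI SUP_least) (auto intro: INF_lower2)
qed

text \<open>Countably many radii suffice, so the corresponding almost sure events can later be
  intersected.\<close>

lemma hausdorff_dist_tendsto_0:
  assumes ne: "\<And>n. A n \<noteq> {}" "B \<noteq> {}" and nonneg: "\<And>n a b. a \<in> A n \<Longrightarrow> b \<in> B \<Longrightarrow> 0 \<le> d a b"
    and ev: "\<And>N. \<forall>\<^sub>F n in sequentially. \<forall>a\<in>A n. \<forall>b\<in>B. d a b \<le> 1 / real (Suc N)"
  shows "(\<lambda>n. hausdorff_dist d (A n) B) \<longlonglongrightarrow> 0"
proof (rule order_tendstoI)
  fix c :: ereal
  have bnd: "\<forall>\<^sub>F n in sequentially. 0 \<le> hausdorff_dist d (A n) B
      \<and> hausdorff_dist d (A n) B \<le> ereal (1 / real (Suc N))" for N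
    using ev[of N]
  proof eventually_elim
    case (elim n)
    show ?case
      by (intro conjI hausdorff_dist_bounds ne) (use elim nonneg in auto)
  qed
  { assume "c < 0"
    then show "\<forall>\<^sub>F n in sequentially. c < hausdorff_dist d (A n) B"
      using bnd[of 0] by (auto elim!: eventually_mono intro: less_le_trans) }
  assume "0 < c"
  then obtain r where r: "0 < ereal r" "ereal r < c" using ereal_dense2[of 0 c] by auto
  then obtain N where "1 / real (Suc N) < r" using nat_approx_posE[of r] by auto
  then have "ereal (1 / real (Suc N)) < c" using r(2) by (intro less_trans[OF _ r(2)]) simp
  then show "\<forall>\<^sub>F n in sequentially. hausdorff_dist d (A n) B < c"
    using bnd[of N] by (auto elim!: eventually_mono intro: le_less_trans)
qed

section \<open>Consistency\<close>

text \<open>Quadratic growth of \<open>g\<close> bounds the fourth moments of the centred variables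
  \<open>g (X i \<omega>) - c\<close> uniformly in \<open>i\<close>, so the fourth-moment law
  applies to them.\<close>

lemma (in prob_space) strong_law_mixture:
  fixes X :: "nat \<Rightarrow> 'a \<Rightarrow> real" and \<theta> :: "'k::finite param"
  assumes \<epsilon>: "0 < \<epsilon>" and \<theta>: "\<theta> \<in> sieve m \<epsilon>"
    and indep: "indep_vars (\<lambda>_. borel) X UNIV"
    and distr: "\<And>i. distributed M lborel (X i) (\<lambda>x. ennreal (mixture_density \<theta> x))"
    and [measurable]: "g \<in> borel_measurable borel" and g: "\<And>x. \<bar>g x\<bar> \<le> C * (1 + x\<^sup>2)"
  shows "AE \<omega> in M. (\<lambda>n. (\<Sum>i<n. g (X i \<omega>)) / n) \<longlonglongrightarrow> (\<integral>x. mixture_density \<theta> x * g x \<partial>lborel)"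
proof -
  define c where "c = (\<integral>x. mixture_density \<theta> x * g x \<partial>lborel)"
  have nonneg: "0 \<le> mixture_density \<theta> x" for x
    using mixture_density_pos[OF \<epsilon> \<theta>, of x] by simp
  have int: "integrable M (\<lambda>\<omega>. h (X i \<omega>))"
    and E: "expectation (\<lambda>\<omega>. h (X i \<omega>)) = (\<integral>x. mixture_density \<theta> x * h x \<partial>lborel)"
    if [measurable]: "h \<in> borel_measurable borel" and h: "\<And>x. \<bar>h x\<bar> \<le> D * (1 + x\<^sup>2) ^ n" for h D n i
  proof -
    show "integrable M (\<lambda>\<omega>. h (X i \<omega>))"
      using integrable_mixture_density_mult[OF that, of \<theta>]
      by (subst distributed_integrable[OF distr, symmetric]) (auto simp: nonneg)
    show "expectation (\<lambda>\<omega>. h (X i \<omega>)) = (\<integral>x. mixture_density \<theta> x * h x \<partial>lborel)"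
      by (subst distributed_integral[OF distr]) (auto simp: nonneg)
  qed
  have 4: "\<bar>(g x - c) ^ 4\<bar> \<le> (C + \<bar>c\<bar>) ^ 4 * (1 + x\<^sup>2) ^ 4" for x
  proof -
    have "\<bar>g x - c\<bar> \<le> C * (1 + x\<^sup>2) + \<bar>c\<bar>" using g[of x] by linarith
    also have "\<dots> \<le> (C + \<bar>c\<bar>) * (1 + x\<^sup>2)" by (simp add: algebra_simps)
    finally have "\<bar>g x - c\<bar> ^ 4 \<le> ((C + \<bar>c\<bar>) * (1 + x\<^sup>2)) ^ 4" by (intro power_mono) auto
    then show ?thesis by (simp only: power_abs power_mult_distrib)
  qed
  have "AE \<omega> in M. (\<lambda>n. (\<Sum>i<n. g (X i \<omega>) - c) / n) \<longlonglongrightarrow> 0"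
  proof (rule strong_law_fourth_moment)
    show "indep_vars (\<lambda>_. borel) (\<lambda>i \<omega>. g (X i \<omega>) - c) UNIV"
      by (rule indep_vars_compose2[OF indep]) auto
    show "integrable M (\<lambda>\<omega>. (g (X i \<omega>) - c) ^ 4)" for i
      by (rule int[OF _ 4]) measurable
    show "expectation (\<lambda>\<omega>. g (X i \<omega>) - c) = 0" for i
      using int[of g C 1] E[of g C 1] g by (simp add: prob_space c_def)
    show "expectation (\<lambda>\<omega>. (g (X i \<omega>) - c) ^ 4) \<le> (\<integral>x. mixture_density \<theta> x * (g x - c) ^ 4 \<partial>lborel)" for i
      by (rule eq_refl, rule E[OF _ 4]) measurable
  qed
  then show ?thesis
  proof eventually_elim
    case (elim \<omega>)
    from tendsto_add[OF elim tendsto_const[of c]]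
    have "(\<lambda>n. (\<Sum>i<n. g (X i \<omega>) - c) / n + c) \<longlonglongrightarrow> c" by simp
    \<comment> \<open>At \<open>n = 0\<close> the left side is \<open>c\<close> and the right side
      0, so the identity is claimed only eventually.\<close>
    moreover have "\<forall>\<^sub>F n in sequentially. (\<Sum>i<n. g (X i \<omega>) - c) / n + c = (\<Sum>i<n. g (X i \<omega>)) / n"
      using eventually_gt_at_top[of 0] by eventually_elim (simp add: sum_subtractf field_simps)
    ultimately show ?case unfolding c_def by (rule Lim_transform_eventually)
  qed
qed

text \<open>A continuous function on a nonempty compact set attains its maximum; the Lipschitz bound
  supplies the continuity.\<close>

lemma sieve_mle_nonempty:
  assumes m: "1 \<le> m" and \<epsilon>: "0 < \<epsilon>" and ne: "(sieve m \<epsilon> :: 'k::finite param set) \<noteq> {}"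
  shows "(sieve_mle m \<epsilon> x n :: 'k param set) \<noteq> {}"
proof -
  obtain C where C: "0 \<le> C" "\<And>\<theta> \<theta>' :: 'k param. \<And>x. \<theta> \<in> sieve m \<epsilon> \<Longrightarrow> \<theta>' \<in> sieve m \<epsilon> \<Longrightarrow>
      \<bar>ln (mixture_density \<theta>' x) - ln (mixture_density \<theta> x)\<bar> \<le> C * (1 + x\<^sup>2) * norm (\<theta> - \<theta>')"
    using abs_ln_mixture_density_diff_le[OF m \<epsilon>] by blast
  have "continuous_on (sieve m \<epsilon>) (\<lambda>\<theta> :: 'k param. ln (mixture_density \<theta> y))" for y
  proof -
    have "(C * (1 + y\<^sup>2))-lipschitz_on (sieve m \<epsilon>) (\<lambda>\<theta> :: 'k param. ln (mixture_density \<theta> y))"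
      proof (rule lipschitz_onI)
      fix \<theta> \<theta>' :: "'k param" assume "\<theta> \<in> sieve m \<epsilon>" "\<theta>' \<in> sieve m \<epsilon>"
      then show "dist (ln (mixture_density \<theta> y)) (ln (mixture_density \<theta>' y)) \<le> C * (1 + y\<^sup>2) * dist \<theta> \<theta>'"
        unfolding dist_norm real_norm_def norm_minus_commute[of \<theta> \<theta>'] by (intro C(2))
    qed (use C(1) in simp)
    then show ?thesis by (rule lipschitz_on_continuous_on)
  qed
  then have cont: "continuous_on (sieve m \<epsilon>) (log_likelihood x n :: 'k param \<Rightarrow> real)"
    unfolding log_likelihood_def by (intro continuous_on_sum) auto
  obtain \<theta> :: "'k param" where "\<theta> \<in> sieve m \<epsilon>"
      "\<forall>\<theta>'::'k param\<in>sieve m \<epsilon>. log_likelihood x n \<theta>' \<le> log_likelihood x n \<theta>"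
    using continuous_attains_sup[OF compact_sieve[OF less_imp_le[OF \<epsilon>]] ne cont] by blast
  then have "\<theta> \<in> sieve_mle m \<epsilon> x n" by (auto simp: sieve_mle_def is_arg_max_linorder)
  then show ?thesis by blast
qed

text \<open>Identifiability supplies the strictness in Gibbs' inequality: equal densities would put
  \<open>\<theta>\<close> on the orbit of \<open>\<theta>\<^sub>0\<close>, at distance 0.\<close>

lemma integral_mixture_ln_ratio_neg:
  fixes \<theta> \<theta>\<^sub>0 :: "'k::finite param"
  assumes m: "1 \<le> m" and \<epsilon>: "0 < \<epsilon>" and \<theta>: "\<theta> \<in> sieve m \<epsilon>" and \<theta>\<^sub>0: "\<theta>\<^sub>0 \<in> sieve m \<epsilon>"
    and \<theta>\<^sub>0_eq: "\<theta>\<^sub>0 = (\<pi>\<^sub>0, \<mu>\<^sub>0, t\<^sub>0)"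
    and dist: "\<And>j l. j \<noteq> l \<Longrightarrow> (\<mu>\<^sub>0 $ j, t\<^sub>0 $ j) \<noteq> (\<mu>\<^sub>0 $ l, t\<^sub>0 $ l)"
    and pd: "0 < perm_dist \<theta> \<theta>\<^sub>0"
  shows "(\<integral>x. mixture_density \<theta>\<^sub>0 x * (ln (mixture_density \<theta> x) - ln (mixture_density \<theta>\<^sub>0 x)) \<partial>lborel) < 0"
proof (rule integral_ln_ratio_neg)
  obtain C where "0 \<le> C" and C: "\<And>\<theta> \<theta>' :: 'k param. \<And>x. \<theta> \<in> sieve m \<epsilon> \<Longrightarrow> \<theta>' \<in> sieve m \<epsilon> \<Longrightarrow>
      \<bar>ln (mixture_density \<theta>' x) - ln (mixture_density \<theta> x)\<bar> \<le> C * (1 + x\<^sup>2) * norm (\<theta> - \<theta>')"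
    using abs_ln_mixture_density_diff_le[OF m \<epsilon>] by blast
  show "integrable lborel (\<lambda>x. mixture_density \<theta>\<^sub>0 x * (ln (mixture_density \<theta> x) - ln (mixture_density \<theta>\<^sub>0 x)))"
    using C[OF \<theta>\<^sub>0 \<theta>]
    by (intro integrable_mixture_density_mult[where n = 1 and C = "C * norm (\<theta>\<^sub>0 - \<theta>)"]) (auto simp: mult_ac)
  show "integrable lborel (mixture_density \<theta>\<^sub>0)" "integrable lborel (mixture_density \<theta>)"
    using integrable_mixture_density_power[of _ 0] by simp_all
  show "mixture_density \<theta>\<^sub>0 \<noteq> mixture_density \<theta>"
  proof
    assume eq: "mixture_density \<theta>\<^sub>0 = mixture_density \<theta>"
    obtain p \<mu> t where \<theta>_eq: "\<theta> = (p, \<mu>, t)" by (metis prod_cases3)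
    have pos: "0 < \<pi>\<^sub>0 $ j" for j
      using sieveD(1)[OF \<theta>\<^sub>0[unfolded \<theta>\<^sub>0_eq], of j] \<epsilon> by linarith
    obtain \<tau> where \<tau>: "\<tau> permutes UNIV" "\<theta> = perm_act \<tau> \<theta>\<^sub>0"
      using mixture_identifiable[of p \<mu> t \<pi>\<^sub>0 \<mu>\<^sub>0 t\<^sub>0] eq pos dist unfolding \<theta>_eq \<theta>\<^sub>0_eq by metis
    then show False using perm_dist_le[of \<tau> \<theta> \<theta>\<^sub>0] pd by simp
  qed
qed (rule mixture_density_continuous mixture_density_pos[OF \<epsilon> \<theta>] mixture_density_pos[OF \<epsilon> \<theta>\<^sub>0]
    | simp add: integral_mixture_density[OF \<theta>] integral_mixture_density[OF \<theta>\<^sub>0])+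

lemma (in prob_space) sieve_mle_consistent:
  fixes X :: "nat \<Rightarrow> 'a \<Rightarrow> real" and \<theta>\<^sub>0 :: "'k::finite param"
  assumes m: "1 \<le> m" and \<epsilon>: "0 < \<epsilon>" and \<theta>\<^sub>0: "\<theta>\<^sub>0 \<in> sieve m \<epsilon>" and \<theta>\<^sub>0_eq: "\<theta>\<^sub>0 = (\<pi>\<^sub>0, \<mu>\<^sub>0, t\<^sub>0)"
    and dist: "\<And>j l. j \<noteq> l \<Longrightarrow> (\<mu>\<^sub>0 $ j, t\<^sub>0 $ j) \<noteq> (\<mu>\<^sub>0 $ l, t\<^sub>0 $ l)"
    and indep: "indep_vars (\<lambda>_. borel) X UNIV"
    and distr: "\<And>i. distributed M lborel (X i) (\<lambda>x. ennreal (mixture_density \<theta>\<^sub>0 x))"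
    and \<delta>: "0 < \<delta>"
  shows "AE \<omega> in M. \<forall>\<^sub>F n in sequentially. \<forall>\<theta>\<in>sieve_mle m \<epsilon> (\<lambda>i. X i \<omega>) n. perm_dist \<theta> \<theta>\<^sub>0 \<le> \<delta>"
proof -
  obtain C where C: "0 \<le> C" "\<And>\<theta> \<theta>' :: 'k param. \<And>x. \<theta> \<in> sieve m \<epsilon> \<Longrightarrow> \<theta>' \<in> sieve m \<epsilon> \<Longrightarrow>
      \<bar>ln (mixture_density \<theta>' x) - ln (mixture_density \<theta> x)\<bar> \<le> C * (1 + x\<^sup>2) * norm (\<theta> - \<theta>')"
    using abs_ln_mixture_density_diff_le[OF m \<epsilon>] by blast
  define K where "K = sieve m \<epsilon> \<inter> {\<theta> :: 'k param. \<delta> \<le> perm_dist \<theta> \<theta>\<^sub>0}"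
  have "compact K"
    unfolding K_def using compact_sieve[of \<epsilon> m] \<epsilon>
    by (intro compact_Int_closed closed_Collect_le continuous_on_perm_dist continuous_on_const) auto
  define g where "g \<theta> x = ln (mixture_density \<theta> x) - ln (mixture_density \<theta>\<^sub>0 x)" for \<theta> :: "'k param" and x
  define I where "I \<theta> = (\<integral>x. mixture_density \<theta>\<^sub>0 x * g \<theta> x \<partial>lborel)" for \<theta>
  define L where "L = (\<integral>x. mixture_density \<theta>\<^sub>0 x * (1 + x\<^sup>2) \<partial>lborel)"
  have I: "I \<theta> < 0" if "\<theta> \<in> K" for \<theta>
    unfolding I_def g_def
    by (rule integral_mixture_ln_ratio_neg[OF m \<epsilon> _ \<theta>\<^sub>0 \<theta>\<^sub>0_eq dist]) (use that \<delta> in \<open>auto simp: K_def\<close>)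
  have L: "0 \<le> L"
    unfolding L_def using mixture_density_pos[OF \<epsilon> \<theta>\<^sub>0] by (intro Bochner_Integration.integral_nonneg mult_nonneg_nonneg) (auto simp: less_imp_le)
  \<comment> \<open>Within this radius the average log ratio moves by at most half of
    \<open>- I \<theta>\<close> once the average of \<open>1 + x\<^sup>2\<close> is below
    \<open>L + 1\<close>. Using \<open>C + 1\<close> avoids division by 0 when
    \<open>C = 0\<close>.\<close>
  define r where "r \<theta> = - I \<theta> / (2 * (C + 1) * (L + 1))" for \<theta>
  have r: "0 < r \<theta>" if "\<theta> \<in> K" for \<theta>
    unfolding r_def using I[OF that] L C(1) by (intro divide_pos_pos mult_pos_pos) auto
  have Cr: "C * r \<theta> * (L + 1) \<le> - I \<theta> / 2" if "\<theta> \<in> K" for \<theta>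
  proof -
    have "C * r \<theta> * (L + 1) \<le> (C + 1) * r \<theta> * (L + 1)"
      using r[OF that] L by (intro mult_right_mono) auto
    also have "\<dots> = - I \<theta> / 2"
    proof -
      have "a * (i / (2 * a * b)) * b = i / 2" if "a \<noteq> 0" "b \<noteq> 0" for a b i :: real
        using that by simp
      from this[of "C + 1" "L + 1"] show ?thesis unfolding r_def using L C(1) by auto
    qed
    finally show ?thesis .
  qed
  \<comment> \<open>The radius varies with the centre; a finite subcover leaves only finitely many
    null sets and thresholds for \<open>n\<close>.\<close>
  obtain D where D: "D \<subseteq> K" "finite D" "K \<subseteq> (\<Union>\<theta>\<in>D. ball \<theta> (r \<theta>))"
    by (rule compactE_image[OF \<open>compact K\<close>, of K "\<lambda>\<theta>. ball \<theta> (r \<theta>)"]) (use r in auto)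
  note slln = strong_law_mixture[OF \<epsilon> \<theta>\<^sub>0 indep distr]
  have "AE \<omega> in M. \<forall>\<theta>\<in>D. (\<lambda>n. (\<Sum>i<n. g \<theta> (X i \<omega>)) / n) \<longlonglongrightarrow> I \<theta>"
  proof (rule AE_finite_allI[OF D(2)])
    fix \<theta> assume "\<theta> \<in> D"
    then have "\<theta> \<in> sieve m \<epsilon>" using D(1) by (auto simp: K_def)
    from C(2)[OF \<theta>\<^sub>0 this]
    show "AE \<omega> in M. (\<lambda>n. (\<Sum>i<n. g \<theta> (X i \<omega>)) / n) \<longlonglongrightarrow> I \<theta>"
      unfolding I_def by (intro slln[where C = "C * norm (\<theta>\<^sub>0 - \<theta>)"]) (auto simp: g_def mult_ac)
  qed
  moreover have "AE \<omega> in M. (\<lambda>n. (\<Sum>i<n. 1 + (X i \<omega>)\<^sup>2) / n) \<longlonglongrightarrow> L"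
    unfolding L_def by (rule slln[where C = 1]) auto
  ultimately show ?thesis
  proof eventually_elim
    case (elim \<omega>)
    have "\<forall>\<^sub>F n in sequentially. \<forall>\<theta>\<in>D. (\<Sum>i<n. g \<theta> (X i \<omega>)) / n < I \<theta> / 2"
      using elim(1) I D(1) by (intro eventually_ball_finite D(2) ballI order_tendstoD(2)) auto
    moreover have "\<forall>\<^sub>F n in sequentially. (\<Sum>i<n. 1 + (X i \<omega>)\<^sup>2) / n < L + 1"
      by (rule order_tendstoD(2)[OF elim(2)]) simp
    ultimately show ?case using eventually_gt_at_top[of 0]
    proof eventually_elim
      case (elim n)
      show ?case
      proof (intro ballI, rule ccontr)
        fix \<theta>' assume mle: "\<theta>' \<in> sieve_mle m \<epsilon> (\<lambda>i. X i \<omega>) n" and "\<not> perm_dist \<theta>' \<theta>\<^sub>0 \<le> \<delta>"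
        then have K': "\<theta>' \<in> K" by (auto simp: K_def sieve_mle_def is_arg_max_def)
        then have "\<theta>' \<in> (\<Union>\<theta>\<in>D. ball \<theta> (r \<theta>))" by (rule subsetD[OF D(3)])
        then obtain \<theta> where "\<theta> \<in> D" "\<theta>' \<in> ball \<theta> (r \<theta>)" by (rule UN_E)
        then have \<theta>: "\<theta> \<in> D" "\<theta> \<in> K" "norm (\<theta> - \<theta>') < r \<theta>"
          using D(1) by (auto simp: dist_norm)
        \<comment> \<open>A maximizer in \<open>K\<close> is compared with
          \<open>\<theta>\<^sub>0\<close>, itself in the sieve, by way of the centre of a ball
          containing the maximizer.\<close>
        have "log_likelihood (\<lambda>i. X i \<omega>) n \<theta>' - log_likelihood (\<lambda>i. X i \<omega>) n \<theta>\<^sub>0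
            = (\<Sum>i<n. g \<theta>' (X i \<omega>))"
          by (simp add: log_likelihood_def g_def sum_subtractf)
        also have "\<dots> \<le> (\<Sum>i<n. g \<theta> (X i \<omega>) + C * (1 + (X i \<omega>)\<^sup>2) * r \<theta>)"
        proof (intro sum_mono)
          fix i
          have "g \<theta>' (X i \<omega>) - g \<theta> (X i \<omega>) \<le> C * (1 + (X i \<omega>)\<^sup>2) * norm (\<theta> - \<theta>')"
            using C(2)[of \<theta> \<theta>' "X i \<omega>"] \<theta>(2) K' by (simp add: K_def g_def abs_le_iff)
          also have "\<dots> \<le> C * (1 + (X i \<omega>)\<^sup>2) * r \<theta>"
            using \<theta>(3) C(1) by (intro mult_left_mono) auto
          finally show "g \<theta>' (X i \<omega>) \<le> g \<theta> (X i \<omega>) + C * (1 + (X i \<omega>)\<^sup>2) * r \<theta>" by simp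
        qed
        also have "\<dots> = (\<Sum>i<n. g \<theta> (X i \<omega>)) + C * r \<theta> * (\<Sum>i<n. 1 + (X i \<omega>)\<^sup>2)"
          unfolding sum_distrib_left sum.distrib[symmetric] by (simp only: mult_ac)
        also have "\<dots> = n * ((\<Sum>i<n. g \<theta> (X i \<omega>)) / n + C * r \<theta> * ((\<Sum>i<n. 1 + (X i \<omega>)\<^sup>2) / n))"
          using elim(3) by (simp only: distrib_left mult.left_commute[of "real n"]) simp
        \<comment> \<open>Strictness comes from the average at the centre lying below
          \<open>I \<theta> / 2\<close>; the choice of \<open>r\<close> cancels the rest.\<close>
        also have "\<dots> < n * (I \<theta> / 2 + C * r \<theta> * (L + 1))"
          using elim \<theta>(1) C(1) r[OF \<theta>(2)]
          by (intro mult_strict_left_mono add_less_le_mono mult_left_mono) auto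
        also have "\<dots> \<le> 0" using Cr[OF \<theta>(2)] by (intro mult_nonneg_nonpos) auto
        finally have "log_likelihood (\<lambda>i. X i \<omega>) n \<theta>' < log_likelihood (\<lambda>i. X i \<omega>) n \<theta>\<^sub>0" by simp
        then show False using mle \<theta>\<^sub>0 unfolding sieve_mle_def is_arg_max_def by blast
      qed
    qed
  qed
qed

theorem theorem4p8:
  fixes M :: "'w measure" and X :: "nat \<Rightarrow> 'w \<Rightarrow> real"
    and m \<epsilon> :: real and \<pi>\<^sub>0 \<mu>\<^sub>0 t\<^sub>0 :: "real ^ 'k"
  assumes "CARD('k) \<ge> 2" and "m \<ge> 1" and "0 < \<epsilon>" and "\<epsilon> \<le> 1 / real CARD('k)"
    and "(\<pi>\<^sub>0, \<mu>\<^sub>0, t\<^sub>0) \<in> sieve m \<epsilon>"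
    and "(MIN j. \<pi>\<^sub>0 $ j) > 0"
    and "\<And>j l. j \<noteq> l \<Longrightarrow> (\<mu>\<^sub>0 $ j, t\<^sub>0 $ j) \<noteq> (\<mu>\<^sub>0 $ l, t\<^sub>0 $ l)"
    and "prob_space M"
    and "prob_space.indep_vars M (\<lambda>_. borel) X UNIV"
    and "\<And>i. distributed M lborel (X i) (\<lambda>x. ennreal (mixture_density (\<pi>\<^sub>0, \<mu>\<^sub>0, t\<^sub>0) x))"
  shows "(AE \<omega> in M. (\<lambda>n. hausdorff_dist perm_dist
            (sieve_mle m \<epsilon> (\<lambda>i. X i \<omega>) n) (perm_orbit (\<pi>\<^sub>0, \<mu>\<^sub>0, t\<^sub>0))) \<longlonglongrightarrow> 0)
       \<and> (AE \<omega> in M. (\<lambda>n. hausdorff_dist orbit_dist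
            (perm_orbit ` sieve_mle m \<epsilon> (\<lambda>i. X i \<omega>) n) {perm_orbit (\<pi>\<^sub>0, \<mu>\<^sub>0, t\<^sub>0)}) \<longlonglongrightarrow> 0)"
proof -
  interpret prob_space M by fact
  let ?\<theta>\<^sub>0 = "(\<pi>\<^sub>0, \<mu>\<^sub>0, t\<^sub>0)"
  let ?A = "\<lambda>\<omega> n. sieve_mle m \<epsilon> (\<lambda>i. X i \<omega>) n :: 'k param set"
  have ne: "?A \<omega> n \<noteq> {}" for \<omega> n
    by (rule sieve_mle_nonempty) (use assms(2,3,5) in auto)
  \<comment> \<open>All points of the orbit are equally far from \<open>\<theta>\<close>, so
    closeness to \<open>\<theta>\<^sub>0\<close> controls both directions of the Hausdorff
    distance.\<close>
  have orbit: "perm_dist \<theta> \<theta>' = perm_dist \<theta> ?\<theta>\<^sub>0" if "\<theta>' \<in> perm_orbit ?\<theta>\<^sub>0" for \<theta> \<theta>'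
    using that perm_dist_act[OF permutes_id, of _ \<theta> ?\<theta>\<^sub>0] by (auto simp: perm_orbit_def perm_act_id)
  \<comment> \<open>One almost sure event for all radii; both forms of the convergence hold on
    it.\<close>
  have ev: "AE \<omega> in M. \<forall>N. \<forall>\<^sub>F n in sequentially. \<forall>\<theta>\<in>?A \<omega> n. perm_dist \<theta> ?\<theta>\<^sub>0 \<le> 1 / real (Suc N)"
    unfolding AE_all_countable
    by (intro allI sieve_mle_consistent[OF assms(2,3,5) refl assms(7,9,10)]) auto
  have "AE \<omega> in M. (\<lambda>n. hausdorff_dist perm_dist (?A \<omega> n) (perm_orbit ?\<theta>\<^sub>0)) \<longlonglongrightarrow> 0"
    using ev
  proof eventually_elim
    case (elim \<omega>)
    have "perm_orbit ?\<theta>\<^sub>0 \<noteq> {}" using perm_orbit_refl by auto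
    then show ?case
      by (intro hausdorff_dist_tendsto_0 ne perm_dist_nonneg) (use elim in \<open>simp_all add: orbit\<close>)
  qed
  moreover have "AE \<omega> in M. (\<lambda>n. hausdorff_dist orbit_dist (perm_orbit ` ?A \<omega> n) {perm_orbit ?\<theta>\<^sub>0}) \<longlonglongrightarrow> 0"
    using ev
  proof eventually_elim
    case (elim \<omega>)
    then show ?case
      by (intro hausdorff_dist_tendsto_0)
        (auto simp: ne orbit_dist_perm_orbit perm_dist_nonneg)
  qed
  ultimately show ?thesis by blast
qed

end
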